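(* There is a positive numerical constant $C$ such that the following holds. Let $f(z)=\sum_{n\ge0}a_n\xi_nz^n$ be a Rademacher entire function with $a_0=1$. Then there is a non-random set $E\subset[1,\infty)$ of finite logarithmic measure such that, almost surely, there is a (random) $r_0(\omega)\ge1$ with $$\bigl|n_f(r)-s_f(r)\bigr|\le C\sqrt{s_f(r)}\,\log^4s_f(r)\qquad\text{for every } r\ge r_0(\omega),\ r\notin E .$$
   Context: Rademacher entire function: $(a_n)_{n\ge0}$ is a non-random sequence of complex numbers such that $\sum_{n\ge0} a_nz^n$ is entire, and $(\xi_n)_{n\ge0}$ are independent random variables taking each of the values $\pm1$ with probability $1/2$; $\omega$ denotes a point of the underlying probability space. $n_f(r)$ is the number of zeros of $f$, counted with multiplicities, in the disk $\{|z|\le r\}$. $\sigma_f^2(r)=\sum_{n\ge0}|a_n|^2r^{2n}$ with $\sigma_f\ge0$, and $s_f(r)=\frac{d\log\sigma_f(r)}{d\log r}=r\,\frac{\sigma_f'(r)}{\sigma_f(r)}$. A set $E\subset[1,\infty)$ has finite logarithmic measure if $\int_E\frac{dt}{t}<\infty$.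
   Formalization: Polynomials f of degree exactly one are excluded: for them the error is 1/(1+|a_1|^2r^2) while log^4 s_f decays like |a_1 r|^{-8}, so the bound fails. C is stated per type of sample points; as the law of the signs is fixed, one C serves all. *)

theory Defs
  imports "HOL-Probability.Probability" "HOL-Complex_Analysis.Complex_Analysis"
begin

definition rademacher_sequence :: "'w measure \<Rightarrow> (nat \<Rightarrow> 'w \<Rightarrow> real) \<Rightarrow> bool" where
  "rademacher_sequence M \<xi> \<longleftrightarrow>
     prob_space M \<and>
     prob_space.indep_vars M (\<lambda>_. borel) \<xi> UNIV \<and>
     (\<forall>n. measure M {\<omega> \<in> space M. \<xi> n \<omega> = 1} = 1/2 \<and>
          measure M {\<omega> \<in> space M. \<xi> n \<omega> = -1} = 1/2)"

definition signed_series :: "(nat \<Rightarrow> complex) \<Rightarrow> (nat \<Rightarrow> real) \<Rightarrow> complex \<Rightarrow> complex" where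
  "signed_series a x z = (\<Sum>n. a n * of_real (x n) * z ^ n)"

text \<open>\<^const>\<open>zorder\<close> is the multiplicity at a zero of a holomorphic function that is not
  identically zero.  A sum over an infinite set of zeros would be \<open>0\<close> by convention, but an entire function
  that does not vanish at the origin has finitely many zeros in each disk.\<close>

definition zero_count :: "(complex \<Rightarrow> complex) \<Rightarrow> real \<Rightarrow> nat" where
  "zero_count f r = (\<Sum>z | norm z \<le> r \<and> f z = 0. nat (zorder f z))"

definition sigma :: "(nat \<Rightarrow> complex) \<Rightarrow> real \<Rightarrow> real" where
  "sigma a r = sqrt (\<Sum>n. (norm (a n))\<^sup>2 * r ^ (2 * n))"

definition log_deriv_sigma :: "(nat \<Rightarrow> complex) \<Rightarrow> real \<Rightarrow> real" where
  "log_deriv_sigma a r = r * deriv (sigma a) r / sigma a r"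

text \<open>For a polynomial \<open>1 + a\<^sub>1 \<xi>\<^sub>1 z\<close> of degree one put \<open>q = |a\<^sub>1|\<^sup>2 r\<^sup>2\<close>. Then the value here is \<open>q / (1 + q)\<close>,
  which tends to \<open>1\<close>, the number of zeros, with error \<open>1 / (1 + q)\<close>, whereas the fourth power of
  its logarithm is at most \<open>1 / q ^ 4\<close>. So the zero count estimate fails for degree one, which has
  to be excluded.\<close>

definition finite_log_measure :: "real set \<Rightarrow> bool" where
  "finite_log_measure E \<longleftrightarrow>
     E \<subseteq> {1..} \<and> E \<in> sets lebesgue \<and> (\<integral>\<^sup>+t\<in>E. ennreal (1 / t) \<partial>lebesgue) < \<infinity>"

text \<open>An almost sure property of one particular Rademacher sequence holds almost surely for all of
  them, on every probability space, because the law of the sequence is determined. Hence a constant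
  that is valid for all Rademacher sequences over the sample type \<^typ>\<open>nat \<Rightarrow> bool\<close> is valid
  over every other sample type.\<close>

definition coin_space :: "(nat \<Rightarrow> bool) measure" where
  "coin_space = PiM UNIV (\<lambda>_. measure_pmf (bernoulli_pmf (1/2)))"

definition coin_sign :: "nat \<Rightarrow> (nat \<Rightarrow> bool) \<Rightarrow> real" where
  "coin_sign n b = (if b n then 1 else -1)"

lemma rademacher_sequence_coin: "rademacher_sequence coin_space coin_sign"
proof -
  interpret P: product_prob_space "\<lambda>_::nat. measure_pmf (bernoulli_pmf (1/2))" UNIV
    by unfold_locales
  have ps: "prob_space coin_space"
    unfolding coin_space_def by (rule P.P.prob_space_axioms)
  then interpret C: prob_space coin_space .
  have comp: "(\<lambda>b. b n) \<in> coin_space \<rightarrow>\<^sub>M measure_pmf (bernoulli_pmf (1/2))" for n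
    unfolding coin_space_def by (rule measurable_component_singleton) simp
  have dist: "distr coin_space (measure_pmf (bernoulli_pmf (1/2))) (\<lambda>b. b n)
      = measure_pmf (bernoulli_pmf (1/2))" for n
    unfolding coin_space_def by (rule P.PiM_component) simp
  have ind: "C.indep_vars (\<lambda>_. measure_pmf (bernoulli_pmf (1/2))) (\<lambda>n b. b n) UNIV"
  proof (subst C.indep_vars_iff_distr_eq_PiM')
    show "distr coin_space (PiM UNIV (\<lambda>_. measure_pmf (bernoulli_pmf (1/2)))) (\<lambda>x. \<lambda>i\<in>UNIV. x i)
      = PiM UNIV (\<lambda>i. distr coin_space (measure_pmf (bernoulli_pmf (1/2))) (\<lambda>x. x i))"
      unfolding dist by (simp add: coin_space_def restrict_def distr_id2)
  qed (use comp in auto)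
  have "C.indep_vars (\<lambda>_. borel) (\<lambda>n b. (\<lambda>c. if c then 1 else -1 :: real) (b n)) UNIV"
    by (rule C.indep_vars_compose2[OF ind]) auto
  then have ind': "C.indep_vars (\<lambda>_. borel) coin_sign UNIV"
    by (simp add: coin_sign_def[abs_def])
  have m: "measure coin_space {b \<in> space coin_space. b n \<in> A}
      = measure (measure_pmf (bernoulli_pmf (1/2))) A" for n A
  proof -
    have "measure (measure_pmf (bernoulli_pmf (1/2))) A
      = measure (distr coin_space (measure_pmf (bernoulli_pmf (1/2))) (\<lambda>b. b n)) A"
      by (simp only: dist)
    also have "\<dots> = measure coin_space {b \<in> space coin_space. b n \<in> A}"
      using comp by (subst measure_distr) (auto intro!: arg_cong[where f="measure coin_space"])
    finally show ?thesis by simp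
  qed
  have "measure coin_space {b \<in> space coin_space. coin_sign n b = 1} = 1/2"
       "measure coin_space {b \<in> space coin_space. coin_sign n b = -1} = 1/2" for n
  proof -
    have "{b \<in> space coin_space. coin_sign n b = 1} = {b \<in> space coin_space. b n \<in> {True}}"
         "{b \<in> space coin_space. coin_sign n b = -1} = {b \<in> space coin_space. b n \<in> {False}}"
      by (auto simp: coin_sign_def)
    then show "measure coin_space {b \<in> space coin_space. coin_sign n b = 1} = 1/2"
       "measure coin_space {b \<in> space coin_space. coin_sign n b = -1} = 1/2"
      by (simp_all only: m measure_pmf_single) simp_all
  qed
  with ps ind' show ?thesis unfolding rademacher_sequence_def by blast
qed

lemma AE_rademacher_transfer:
  assumes R: "rademacher_sequence M \<xi>"
    and P: "AE b in coin_space. P (\<lambda>n. coin_sign n b)"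
  shows "AE \<omega> in M. P (\<lambda>n. \<xi> n \<omega>)"
proof -
  let ?B = "measure_pmf (bernoulli_pmf (1/2))"
  interpret M: prob_space M using R by (simp add: rademacher_sequence_def)
  have ind: "M.indep_vars (\<lambda>_. borel) \<xi> UNIV" using R by (simp add: rademacher_sequence_def)
  then have meas [measurable]: "\<xi> n \<in> borel_measurable M" for n
    by (auto simp: M.indep_vars_def)
  define \<beta> where "\<beta> = (\<lambda>n \<omega>. \<xi> n \<omega> = 1)"
  have "M.indep_vars (\<lambda>_. ?B) (\<lambda>n \<omega>. (\<lambda>x. x = 1) (\<xi> n \<omega>)) UNIV"
    by (rule M.indep_vars_compose2[OF ind]) auto
  then have ind\<beta>: "M.indep_vars (\<lambda>_. ?B) \<beta> UNIV" by (simp add: \<beta>_def)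
  have meas\<beta>: "\<beta> n \<in> M \<rightarrow>\<^sub>M ?B" for n
    using ind\<beta> by (auto simp: M.indep_vars_def)
  have p1: "M.prob {\<omega> \<in> space M. \<xi> n \<omega> = 1} = 1/2"
    and pm: "M.prob {\<omega> \<in> space M. \<xi> n \<omega> = -1} = 1/2" for n
    using R by (auto simp: rademacher_sequence_def)
  have dist: "distr M ?B (\<beta> n) = ?B" for n
  proof (rule measure_eqI_countable[where A = UNIV])
    fix c
    have "emeasure (distr M ?B (\<beta> n)) {c} = M.prob {\<omega> \<in> space M. \<beta> n \<omega> = c}"
      using meas\<beta>[of n] by (subst emeasure_distr)
        (auto simp: M.emeasure_eq_measure intro!: arg_cong[where f=M.prob])
    also have "M.prob {\<omega> \<in> space M. \<beta> n \<omega> = c} = 1/2"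
    proof (cases c)
      case True then show ?thesis using p1[of n] by (simp add: \<beta>_def)
    next
      case False
      have "M.prob {\<omega> \<in> space M. \<not> \<xi> n \<omega> = 1} = 1 - M.prob {\<omega> \<in> space M. \<xi> n \<omega> = 1}"
        by (rule M.prob_neg) simp
      then show ?thesis using False p1[of n] by (simp add: \<beta>_def)
    qed
    also have "ennreal (1/2) = emeasure ?B {c}"
      by (cases c) (simp_all add: emeasure_pmf_single)
    finally show "emeasure (distr M ?B (\<beta> n)) {c} = emeasure ?B {c}" .
  qed auto
  have "distr M (PiM UNIV (\<lambda>_. ?B)) (\<lambda>\<omega>. \<lambda>n\<in>UNIV. \<beta> n \<omega>) = PiM UNIV (\<lambda>n. distr M ?B (\<beta> n))"
    using ind\<beta> meas\<beta> by (subst (asm) M.indep_vars_iff_distr_eq_PiM') auto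
  then have law: "distr M coin_space (\<lambda>\<omega> n. \<beta> n \<omega>) = coin_space"
    by (simp add: dist coin_space_def restrict_def)
  have mm: "(\<lambda>\<omega> n. \<beta> n \<omega>) \<in> M \<rightarrow>\<^sub>M coin_space"
    unfolding coin_space_def using meas\<beta> by (intro measurable_PiM_single') auto
  have "AE \<omega> in M. P (\<lambda>n. coin_sign n (\<lambda>n. \<beta> n \<omega>))"
    by (rule AE_distrD[OF mm, unfolded law, OF P])
  moreover have "AE \<omega> in M. \<forall>n. \<xi> n \<omega> = 1 \<or> \<xi> n \<omega> = -1"
    unfolding AE_all_countable
  proof
    fix n
    have "M.prob {\<omega> \<in> space M. \<xi> n \<omega> = 1 \<or> \<xi> n \<omega> = -1} =
        M.prob ({\<omega> \<in> space M. \<xi> n \<omega> = 1} \<union> {\<omega> \<in> space M. \<xi> n \<omega> = -1})"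
      by (rule arg_cong[where f=M.prob]) auto
    also have "\<dots> = 1"
      by (subst M.finite_measure_Union) (auto simp: p1 pm)
    finally have "M.prob {\<omega> \<in> space M. \<xi> n \<omega> = 1 \<or> \<xi> n \<omega> = -1} = 1" .
    then show "AE \<omega> in M. \<xi> n \<omega> = 1 \<or> \<xi> n \<omega> = -1"
      by (subst (asm) M.prob_Collect_eq_1) auto
  qed
  ultimately show ?thesis
  proof eventually_elim
    case (elim \<omega>)
    then have "(\<lambda>n. coin_sign n (\<lambda>n. \<beta> n \<omega>)) = (\<lambda>n. \<xi> n \<omega>)"
      by (auto simp: coin_sign_def \<beta>_def fun_eq_iff)
    with elim show ?case by simp
  qed
qed

end

theory Submission
  imports Defs "HOL-Real_Asymp.Real_Asymp"
begin

text \<open>Put \<open>L(u) = log \<sigma>(e\<^sup>u)\<close> and \<open>N(u) = \<Sum> log\<^sup>+ (e\<^sup>u / |w|)\<close>, summed over the zeros \<open>w\<close> with multiplicity.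
  Both are convex, with derivatives \<open>s\<close> and \<open>n\<close>, so an estimate \<open>|N - L| \<le> A\<close> at two radii at logarithmic
  distance \<open>h\<close> bounds \<open>n\<close> by values of \<open>s\<close> up to \<open>2 A / h\<close>. Take radii \<open>r\<^sub>j\<close> with \<open>s(r\<^sub>j) = j\<^sup>2\<close> and
  \<open>h\<^sub>j = 1 / (j log\<^sup>2 j)\<close>. Only four test radii per interval \<open>[r\<^sub>j, r\<^bsub>j+1\<^esub>]\<close> are needed, and the exceptional
  set consists of the end pieces of the intervals, whose logarithmic lengths are at most \<open>3 h\<^sub>j\<close>.

  At a test radius \<open>R\<close> with \<open>s \<le> m\<close> nearby, \<open>f\<close> behaves like a polynomial of degree about \<open>m\<close> at scale \<open>1 / m\<close>.
  The upper bound for \<open>N\<close> follows from the maximum principle. By Harnack's inequality for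
  \<open>log (M / |G|)\<close>, where \<open>G\<close> is \<open>f\<close> with its Blaschke product removed, the lower bound holds up to
  \<open>O(log\<^sup>2 m)\<close> as soon as every short arc of a slightly smaller circle contains a point where
  \<open>|f| \<ge> exp (- O(log\<^sup>2 m)) \<sigma>\<close>. On one arc let \<open>p = O(log m)\<close> and test \<open>f\<close> at \<open>p\<close> equally spaced points.
  If at least \<open>p\<close> coefficients are not too small, then two sign patterns that differ only at \<open>p\<close> such
  indices cannot both make \<open>f\<close> small at all the test points, since Vandermonde systems are invertible; so the
  failure probability is at most \<open>2\<^bsup>-p\<^esup>\<close>. If fewer than \<open>p\<close> coefficients are that large, then these dominate
  the series and failure is impossible. A union bound over the arcs and the Borel-Cantelli lemma conclude.\<close>

section \<open>Zeros and Blaschke quotients\<close>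

text \<open>Harnack's inequality for the positive harmonic function
  \<open>ln (M / norm (g z))\<close>, here the real part of \<open>k\<close>. A Cayley transform
  centred at \<open>a = k c\<close> carries \<open>k\<close> into the unit disk, and Schwarz's lemma
  is applied to the result. The exponent is the Harnack constant (1 + 1/2) / (1 - 1/2) = 3 at half
  the radius.\<close>

lemma harnack_nonvanishing:
  fixes g :: "complex \<Rightarrow> complex"
  assumes hol: "g holomorphic_on ball c \<rho>" and \<rho>: "\<rho> > 0"
    and nz: "\<And>z. z \<in> ball c \<rho> \<Longrightarrow> g z \<noteq> 0"
    and bd: "\<And>z. z \<in> ball c \<rho> \<Longrightarrow> norm (g z) < M"
    and w: "dist c w \<le> \<rho> / 2"
  shows "norm (g w) / M \<ge> (norm (g c) / M) ^ 3"
proof -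
  have M: "M > 0" using bd[of c] \<rho> by (smt (verit) centre_in_ball norm_ge_zero)
  obtain h where h: "h holomorphic_on ball c \<rho>" "\<And>z. z \<in> ball c \<rho> \<Longrightarrow> g z = exp (h z)"
    using contractible_imp_holomorphic_log[OF hol _ nz] convex_imp_contractible[OF convex_ball] by metis
  define k where "k = (\<lambda>z. of_real (ln M) - h z)"
  have normg: "norm (g z) = M * exp (- Re (k z))" if "z \<in> ball c \<rho>" for z
    using h(2)[OF that] M by (simp add: k_def exp_diff exp_minus)
  have Rek: "Re (k z) > 0" if "z \<in> ball c \<rho>" for z
    using bd[OF that] normg[OF that] M by simp
  define a where "a = k c"
  have Rea: "Re a > 0" using Rek[of c] \<rho> by (simp add: a_def)
  define \<phi> where "\<phi> = (\<lambda>z. (k (c + of_real \<rho> * z) - a) / (k (c + of_real \<rho> * z) + cnj a))"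
  have inb: "c + of_real \<rho> * z \<in> ball c \<rho>" if "norm z < 1" for z
    using that \<rho> by (simp add: dist_norm norm_mult)
  have den: "k (c + of_real \<rho> * z) + cnj a \<noteq> 0" if "norm z < 1" for z
  proof -
    have "Re (k (c + of_real \<rho> * z) + cnj a) > 0" using Rek[OF inb[OF that]] Rea by simp
    then show ?thesis by (metis less_irrefl zero_complex.sel(1))
  qed
  have holk: "k holomorphic_on ball c \<rho>" unfolding k_def by (intro holomorphic_intros h)
  have holk': "(\<lambda>z. k (c + of_real \<rho> * z)) holomorphic_on ball 0 1"
  proof -
    have "(k \<circ> (\<lambda>z. c + of_real \<rho> * z)) holomorphic_on ball 0 1"
      by (intro holomorphic_on_compose_gen[OF _ holk] holomorphic_intros) (use inb in auto)
    then show ?thesis by (simp add: o_def)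
  qed
  have hol\<phi>: "\<phi> holomorphic_on ball 0 1" unfolding \<phi>_def
    by (intro holomorphic_intros holk') (use den in auto)
  \<comment> \<open>This difference is positive when both real parts are, which is why
    \<open>\<phi>\<close> maps into the unit disk.\<close>
  have sq: "norm (u + cnj a) ^ 2 - norm (u - a) ^ 2 = 4 * Re u * Re a" for u :: complex
    unfolding cmod_power2 by (simp add: algebra_simps power2_eq_square)
  have lt1: "norm (\<phi> z) < 1" if "norm z < 1" for z
  proof -
    let ?u = "k (c + of_real \<rho> * z)"
    have "norm (?u - a) ^ 2 < norm (?u + cnj a) ^ 2"
      using sq[of ?u] Rek[OF inb[OF that]] Rea by (smt (verit) mult_pos_pos)
    then have "norm (?u - a) < norm (?u + cnj a)" by (meson norm_ge_zero power2_less_imp_less)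
    then show ?thesis using den[OF that] by (simp add: \<phi>_def norm_divide)
  qed
  define z where "z = (w - c) / of_real \<rho>"
  have z: "norm z \<le> 1/2" using w \<rho> by (simp add: z_def norm_divide dist_norm norm_minus_commute field_simps)
  have wz: "c + of_real \<rho> * z = w" using \<rho> by (simp add: z_def)
  have "norm (\<phi> z) \<le> norm z"
    by (rule Schwarz_Lemma(1)[OF hol\<phi> _ lt1]) (use z in \<open>auto simp: \<phi>_def a_def\<close>)
  then have le: "norm (k w - a) \<le> norm (k w + cnj a) / 2"
  proof -
    have "norm (\<phi> z) * norm (k w + cnj a) \<le> 1/2 * norm (k w + cnj a)"
      using \<open>norm (\<phi> z) \<le> norm z\<close> z by (intro mult_right_mono) auto
    moreover have "norm (\<phi> z) * norm (k w + cnj a) = norm (k w - a)"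
      using den[of z] z by (simp add: \<phi>_def wz norm_divide)
    ultimately show ?thesis by simp
  qed
  \<comment> \<open>Both sides of \<open>le\<close> contain the same imaginary part
    \<open>Im (k w) - Im a\<close>, with the smaller factor on the right, so the inequality survives
    for the real parts alone.\<close>
  have "(Re (k w) - Re a)\<^sup>2 \<le> ((Re (k w) + Re a) / 2)\<^sup>2"
  proof -
    have "norm (k w - a) ^ 2 \<le> (norm (k w + cnj a) / 2) ^ 2"
      using le by (intro power_mono) auto
    then have "(Re (k w) - Re a)\<^sup>2 + (Im (k w) - Im a)\<^sup>2 \<le> ((Re (k w) + Re a)\<^sup>2 + (Im (k w) - Im a)\<^sup>2) / 4"
      unfolding power_divide cmod_power2 by simp
    then have "(Re (k w) - Re a)\<^sup>2 \<le> (Re (k w) + Re a)\<^sup>2 / 4 - 3/4 * (Im (k w) - Im a)\<^sup>2" by argo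
    also have "\<dots> \<le> (Re (k w) + Re a)\<^sup>2 / 4" by simp
    finally show ?thesis by (simp add: power_divide)
  qed
  moreover have wb: "w \<in> ball c \<rho>" using w \<rho> by simp
  ultimately have "\<bar>Re (k w) - Re a\<bar> \<le> \<bar>(Re (k w) + Re a) / 2\<bar>" by (simp only: abs_le_square_iff)
  then have "\<bar>Re (k w) - Re a\<bar> \<le> (Re (k w) + Re a) / 2"
    using Rek[OF wb] Rea by (simp add: abs_of_pos)
  from abs_le_D1[OF this] have "Re (k w) \<le> 3 * Re a" by (simp add: field_simps)
  then have "exp (- Re a) ^ 3 \<le> exp (- Re (k w))"
    by (simp flip: exp_of_nat_mult)
  then show ?thesis
    using normg[OF wb] normg[of c] \<rho> M by (simp add: a_def)
qed

lemma zero_set_finite: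
  assumes hol: "f holomorphic_on UNIV" and f0: "f 0 \<noteq> 0"
  shows "finite {z. norm z \<le> R \<and> f z = 0}"
proof (rule ccontr)
  let ?Z = "{z. norm z \<le> R \<and> f z = 0}"
  assume inf: "infinite ?Z"
  have "?Z \<subseteq> cball 0 R" by auto
  from Heine_Borel_imp_Bolzano_Weierstrass[OF compact_cball inf this]
  obtain x where x: "x islimpt ?Z" by blast
  have "f 0 = 0"
    by (rule analytic_continuation[OF hol open_UNIV connected_UNIV _ _ x]) auto
  with f0 show False by simp
qed

text \<open>Comparing \<open>f\<close> with the polynomial \<open>P\<close> of its zeros in the open
  disk of radius \<open>R + 1\<close> gives a quotient holomorphic past the closed disk of radius
  \<open>R\<close>, as the maximum principle on that disk requires.\<close>

lemma entire_zero_factorization: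
  assumes hol: "f holomorphic_on UNIV" and f0: "f 0 \<noteq> 0"
  defines "Z \<equiv> \<lambda>R. {z. norm z \<le> R \<and> f z = 0}"
  obtains g where "g holomorphic_on ball 0 (R + 1)"
    "\<And>z. norm z \<le> R \<Longrightarrow> g z \<noteq> 0"
    "\<And>z. norm z < R + 1 \<Longrightarrow> f z = g z * (\<Prod>w\<in>Z R. (z - w) ^ nat (zorder f w))"
proof -
  define A where "A = ball (0::complex) (R + 1)"
  define W where "W = {z\<in>A. f z = 0}"
  define m where "m = (\<lambda>w. nat (zorder f w))"
  have finZ: "finite (Z r)" for r unfolding Z_def by (rule zero_set_finite[OF hol f0])
  have finW: "finite W" by (rule finite_subset[OF _ finZ[of "R+1"]]) (auto simp: W_def Z_def A_def)
  have fr: "\<exists>\<^sub>F z in at w. f z \<noteq> 0" for w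
  proof -
    have "eventually (\<lambda>z. f z \<noteq> 0 \<and> z \<in> UNIV) (at w)"
      by (rule non_zero_neighbour_alt[OF hol]) (use f0 in auto)
    then show ?thesis by (intro eventually_frequently) (auto elim: eventually_mono)
  qed
  have mpos: "zorder f w > 0" if "f w = 0" for w
    using zorder_pos_iff[OF hol open_UNIV _ fr, of w] that by simp
  define P where "P = (\<lambda>z. \<Prod>w\<in>W. (z - w) ^ m w)"
  have holP: "P holomorphic_on UNIV" unfolding P_def by (intro holomorphic_intros)
  have ord: "zorder f z = zorder P z" if "z \<in> A" for z
  proof (cases "z \<in> W")
    case True
    define Q where "Q = (\<lambda>u. \<Prod>w\<in>W - {z}. (u - w) ^ m w)"
    have "zorder P z = int (m z)"
    proof (rule zorder_eqI[of UNIV z Q])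
      show "Q holomorphic_on UNIV" unfolding Q_def by (intro holomorphic_intros)
      show "Q z \<noteq> 0" using finW by (auto simp: Q_def)
      fix u show "P u = Q u * (u - z) powi int (m z)"
        unfolding P_def Q_def using finW True by (simp add: prod.remove[of W z] mult.commute)
    qed auto
    then show ?thesis using mpos[of z] True by (simp add: m_def W_def)
  next
    case False
    have "P z \<noteq> 0" using False finW by (auto simp: P_def)
    then have "zorder P z = 0"
      by (intro zorder_eq_0I) (use holP in \<open>auto simp: analytic_at\<close>)
    moreover have "zorder f z = 0"
      by (intro zorder_eq_0I) (use hol False that in \<open>auto simp: analytic_at W_def\<close>)
    ultimately show ?thesis by simp
  qed
  have zeros: "P z = 0 \<longleftrightarrow> f z = 0" if "z \<in> A" for z
  proof -
    have "P z = 0 \<longleftrightarrow> z \<in> W" unfolding P_def using finW mpos by (auto simp: m_def W_def)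
    then show ?thesis using that by (simp add: W_def)
  qed
  have AA: "open A" "connected A" "f holomorphic_on A" "P holomorphic_on A"
    using hol holP by (auto simp: A_def intro: holomorphic_on_subset)
  note fac = holomorphic_zorder_factorization[OF AA(3,1,2,4) zeros ord[symmetric]]
  obtain h where h: "h holomorphic_on A" "\<And>z. z \<in> A \<Longrightarrow> h z \<noteq> 0" "\<And>z. z \<in> A \<Longrightarrow> f z = h z * P z"
    by (rule fac) blast+
  \<comment> \<open>The finitely many zeros with R < |w| < R + 1 are returned to \<open>g\<close>,
    so that only those in the closed disk are split off.\<close>
  define g where "g = (\<lambda>z. h z * (\<Prod>w\<in>W - Z R. (z - w) ^ m w))"
  show ?thesis
  proof (rule that[of g])
    show "g holomorphic_on ball 0 (R + 1)" unfolding g_def by (intro holomorphic_intros) (use h in \<open>auto simp: A_def\<close>)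
    show "g z \<noteq> 0" if "norm z \<le> R" for z
      using that h(2)[of z] finW by (auto simp: g_def A_def W_def Z_def)
    fix z :: complex assume z: "norm z < R + 1"
    have sub: "Z R \<subseteq> W" by (auto simp: Z_def W_def A_def)
    have "P z = (\<Prod>w\<in>W - Z R. (z - w) ^ m w) * (\<Prod>w\<in>Z R. (z - w) ^ m w)"
      unfolding P_def by (rule prod.subset_diff[OF sub finW])
    then show "f z = g z * (\<Prod>w\<in>Z R. (z - w) ^ nat (zorder f w))"
      using h(3)[of z] z by (simp add: g_def A_def m_def)
  qed
qed

text \<open>This is the function N of the outline at \<open>R = exp u\<close>. If
  \<open>norm (f 0) = 1\<close>, Jensen's formula makes it the mean of
  \<open>ln (norm (f z))\<close> over the circle of radius \<open>R\<close>.\<close>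

definition jensen_sum :: "(complex \<Rightarrow> complex) \<Rightarrow> real \<Rightarrow> real" where
  "jensen_sum f R = (\<Sum>w | norm w \<le> R \<and> f w = 0. real (nat (zorder f w)) * ln (R / norm w))"

text \<open>Between the two radii a zero of the smaller disk gains exactly
  \<open>ln (R' / R)\<close>, and a zero of the annulus gains something between 0 and that
  amount.\<close>

lemma jensen_sum_increment:
  assumes hol: "f holomorphic_on UNIV" and f0: "f 0 \<noteq> 0" and R: "0 < R" "R \<le> R'"
  shows "real (zero_count f R) * ln (R' / R) \<le> jensen_sum f R' - jensen_sum f R"
    and "jensen_sum f R' - jensen_sum f R \<le> real (zero_count f R') * ln (R' / R)"
proof -
  define Z where "Z = (\<lambda>R. {z. norm z \<le> R \<and> f z = 0})"
  define m where "m = (\<lambda>w. real (nat (zorder f w)))"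
  have fin: "finite (Z r)" for r unfolding Z_def by (rule zero_set_finite[OF hol f0])
  have sub: "Z R \<subseteq> Z R'" using R by (auto simp: Z_def)
  have pos: "norm w > 0" if "w \<in> Z r" for w r using that f0 by (auto simp: Z_def)
  have J: "jensen_sum f r = (\<Sum>w\<in>Z r. m w * ln (r / norm w))" for r
    by (simp add: jensen_sum_def Z_def m_def)
  have n: "real (zero_count f r) = (\<Sum>w\<in>Z r. m w)" for r
    by (simp add: zero_count_def Z_def m_def)
  have eq: "jensen_sum f R' - jensen_sum f R
      = (\<Sum>w\<in>Z R' - Z R. m w * ln (R' / norm w)) + (\<Sum>w\<in>Z R. m w * ln (R' / R))"
  proof -
    have "(\<Sum>w\<in>Z R. m w * ln (R' / norm w)) - (\<Sum>w\<in>Z R. m w * ln (R / norm w)) = (\<Sum>w\<in>Z R. m w * ln (R' / R))"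
      unfolding sum_subtractf[symmetric]
    proof (rule sum.cong[OF refl])
      fix w assume "w \<in> Z R"
      then show "m w * ln (R' / norm w) - m w * ln (R / norm w) = m w * ln (R' / R)"
        using pos[of w R] R by (simp add: ln_div algebra_simps)
    qed
    then show ?thesis unfolding J sum.subset_diff[OF sub fin] by simp
  qed
  have "0 \<le> (\<Sum>w\<in>Z R' - Z R. m w * ln (R' / norm w))"
    using pos by (intro sum_nonneg mult_nonneg_nonneg) (auto simp: m_def Z_def)
  then show "real (zero_count f R) * ln (R' / R) \<le> jensen_sum f R' - jensen_sum f R"
    unfolding eq n by (simp add: sum_distrib_right)
  have "(\<Sum>w\<in>Z R' - Z R. m w * ln (R' / norm w)) \<le> (\<Sum>w\<in>Z R' - Z R. m w * ln (R' / R))"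
  proof (intro sum_mono mult_left_mono)
    fix w assume w: "w \<in> Z R' - Z R"
    then have "R \<le> norm w" "norm w > 0" using pos[of w R'] by (auto simp: Z_def)
    then show "ln (R' / norm w) \<le> ln (R' / R)" using R by (intro ln_mono divide_left_mono) auto
  qed (simp add: m_def)
  then show "jensen_sum f R' - jensen_sum f R \<le> real (zero_count f R') * ln (R' / R)"
    unfolding eq n sum.subset_diff[OF sub fin] by (simp add: sum_distrib_right distrib_right)
qed

text \<open>The last product vanishes on the circle |z| = R and is nonnegative when z and w lie in
  the closed disk. This yields both modulus comparisons in \<open>blaschke_quotient\<close>.\<close>

lemma blaschke_norm:
  fixes z w :: complex and R :: real
  shows "norm (of_real (R\<^sup>2) - cnj w * z) ^ 2 = (R * norm (z - w)) ^ 2 + (R\<^sup>2 - norm z ^ 2) * (R\<^sup>2 - norm w ^ 2)"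
  unfolding power_mult_distrib cmod_power2
  by (simp add: algebra_simps power2_eq_square)

text \<open>Replacing each zero factor \<open>z - w\<close> by \<open>(R\<^sup>2 - cnj w * z) / R\<close> leaves the modulus on the circle
  \<open>|z| = R\<close> unchanged, and Jensen's formula becomes the value at \<open>0\<close>.\<close>

lemma blaschke_quotient:
  assumes hol: "f holomorphic_on UNIV" and f0: "norm (f 0) = 1" and R: "R > 0"
  obtains G where "G holomorphic_on ball 0 (R + 1)"
    "\<And>z. norm z < R \<Longrightarrow> G z \<noteq> 0"
    "\<And>z. norm z \<le> R \<Longrightarrow> norm (f z) \<le> norm (G z)"
    "\<And>z. norm z = R \<Longrightarrow> norm (f z) = norm (G z)"
    "ln (norm (G 0)) = jensen_sum f R"
proof -
  have f0': "f 0 \<noteq> 0" using f0 by auto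
  define Z where "Z = {z. norm z \<le> R \<and> f z = 0}"
  define m where "m = (\<lambda>w. nat (zorder f w))"
  have fin: "finite Z" unfolding Z_def by (rule zero_set_finite[OF hol f0'])
  obtain g where g: "g holomorphic_on ball 0 (R + 1)" "\<And>z. norm z \<le> R \<Longrightarrow> g z \<noteq> 0"
    and g': "\<And>z. norm z < R + 1 \<Longrightarrow>
      f z = g z * (\<Prod>w | norm w \<le> R \<and> f w = 0. (z - w) ^ nat (zorder f w))"
    by (rule entire_zero_factorization[OF hol f0', of R]) blast
  have g3: "f z = g z * (\<Prod>w\<in>Z. (z - w) ^ m w)" if "norm z < R + 1" for z
    using g'[OF that] by (simp only: Z_def m_def)
  define B where "B = (\<lambda>w z. (of_real (R\<^sup>2) - cnj w * z) / of_real R)"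
  define G where "G = (\<lambda>z. g z * (\<Prod>w\<in>Z. B w z ^ m w))"
  have nB: "norm (B w z) ^ 2 = norm (z - w) ^ 2 + (R\<^sup>2 - norm z ^ 2) * (R\<^sup>2 - norm w ^ 2) / R\<^sup>2" for w z
    unfolding B_def norm_divide power_divide blaschke_norm using R
    by (simp add: add_divide_distrib power_mult_distrib)
  have le: "norm (z - w) \<le> norm (B w z)" if "norm z \<le> R" "w \<in> Z" for z w
  proof (rule power2_le_imp_le)
    show "norm (z - w) ^ 2 \<le> norm (B w z) ^ 2"
      unfolding nB using that by (auto simp: Z_def intro!: divide_nonneg_nonneg mult_nonneg_nonneg power_mono)
  qed simp
  show ?thesis
  proof (rule that[of G])
    show "G holomorphic_on ball 0 (R + 1)" unfolding G_def B_def by (intro holomorphic_intros g) (use R in auto)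
    show "G z \<noteq> 0" if z: "norm z < R" for z
    proof -
      have "B w z \<noteq> 0" if w: "w \<in> Z" for w
      proof -
        have "norm (cnj w * z) < R * R" unfolding norm_mult complex_mod_cnj
          by (rule mult_le_less_imp_less) (use w z f0' in \<open>auto simp: Z_def\<close>)
        moreover have "norm (of_real (R\<^sup>2) :: complex) = R * R" unfolding norm_of_real by (simp add: power2_eq_square)
        ultimately have "cnj w * z \<noteq> of_real (R\<^sup>2)" by (metis less_irrefl)
        then show ?thesis using R by (auto simp: B_def)
      qed
      then show ?thesis using g(2)[of z] z fin by (auto simp: G_def)
    qed
    show "norm (f z) \<le> norm (G z)" if z: "norm z \<le> R" for z
    proof -
      have "(\<Prod>w\<in>Z. norm (z - w) ^ m w) \<le> (\<Prod>w\<in>Z. norm (B w z) ^ m w)"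
        by (intro prod_mono conjI power_mono le[OF z]) auto
      then show ?thesis using g3[of z] z
        by (auto simp: G_def norm_mult prod_norm norm_power simp flip: prod_norm intro!: mult_left_mono)
    qed
    show "norm (f z) = norm (G z)" if z: "norm z = R" for z
    proof -
      have "norm (B w z) ^ 2 = norm (z - w) ^ 2" for w using nB[of w z] z by simp
      then have "norm (B w z) = norm (z - w)" for w by (metis norm_ge_zero power2_eq_imp_eq)
      then have "(\<Prod>w\<in>Z. norm (z - w) ^ m w) = (\<Prod>w\<in>Z. norm (B w z) ^ m w)" by simp
      then show ?thesis using g3[of z] z by (simp add: G_def norm_mult norm_power flip: prod_norm)
    qed
    have pos: "norm w > 0" if "w \<in> Z" for w using that f0' by (auto simp: Z_def)
    \<comment> \<open>At the origin each factor \<open>z - w\<close> has modulus |w|, whereas each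
      Blaschke factor has modulus \<open>R\<close>; the quotient of the two products is the
      exponential of the Jensen sum.\<close>
    have "norm (g 0) * (\<Prod>w\<in>Z. norm w ^ m w) = 1"
      using g3[of 0] f0 R by (simp add: norm_mult norm_power flip: prod_norm)
    moreover have "norm (G 0) = norm (g 0) * (\<Prod>w\<in>Z. R ^ m w)"
      using R by (simp add: G_def B_def norm_mult norm_power power2_eq_square flip: prod_norm)
    ultimately have "norm (G 0) * (\<Prod>w\<in>Z. norm w ^ m w) = (\<Prod>w\<in>Z. R ^ m w)"
      by (metis mult.commute mult.left_commute mult.right_neutral)
    moreover have "(\<Prod>w\<in>Z. norm w ^ m w) > 0" using pos by (intro prod_pos) auto
    ultimately have "norm (G 0) = (\<Prod>w\<in>Z. R ^ m w) / (\<Prod>w\<in>Z. norm w ^ m w)"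
      by (metis less_irrefl nonzero_mult_div_cancel_right)
    also have "\<dots> = (\<Prod>w\<in>Z. (R / norm w) ^ m w)" by (simp add: power_divide prod_dividef)
    also have "ln \<dots> = (\<Sum>w\<in>Z. ln ((R / norm w) ^ m w))"
      by (rule ln_prod) (use fin pos R in auto)
    also have "\<dots> = jensen_sum f R"
      using pos R by (simp add: jensen_sum_def Z_def m_def ln_realpow)
    finally show "ln (norm (G 0)) = jensen_sum f R" .
  qed
qed

section \<open>Bounds for the Jensen sum and for exponential sums\<close>

lemma circle_maximum:
  assumes "G holomorphic_on ball 0 R'" "0 < R" "R < R'"
    and "\<And>z. norm z = R \<Longrightarrow> norm (G z) \<le> M" and "norm w \<le> R"
  shows "norm (G w) \<le> (M::real)"
proof (rule maximum_modulus_frontier[where S = "cball 0 R" and f = G])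
  show "G holomorphic_on interior (cball 0 R)"
    by (rule holomorphic_on_subset[OF assms(1)]) (use assms in auto)
  show "continuous_on (closure (cball 0 R)) G"
    by (rule continuous_on_subset[OF holomorphic_on_imp_continuous_on[OF assms(1)]]) (use assms in auto)
qed (use assms in \<open>auto simp: frontier_def\<close>)

text \<open>The maximum principle for the reciprocal of \<open>G\<close>.\<close>

lemma circle_minimum:
  assumes "G holomorphic_on ball 0 R'" "0 < R" "R < R'"
    and nz: "\<And>z. norm z \<le> R \<Longrightarrow> G z \<noteq> 0"
    and "\<And>z. norm z = R \<Longrightarrow> norm (G z) \<ge> \<epsilon>" and \<epsilon>: "\<epsilon> > 0"
  shows "norm (G 0) \<ge> \<epsilon>"
proof -
  have "norm (inverse (G 0)) \<le> inverse \<epsilon>"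
  proof (rule maximum_modulus_frontier[where S = "cball 0 R" and f = "\<lambda>z. inverse (G z)"])
    show "(\<lambda>z. inverse (G z)) holomorphic_on interior (cball 0 R)"
      by (intro holomorphic_intros holomorphic_on_subset[OF assms(1)]) (use assms in auto)
    show "continuous_on (closure (cball 0 R)) (\<lambda>z. inverse (G z))"
      by (intro continuous_intros continuous_on_subset[OF holomorphic_on_imp_continuous_on[OF assms(1)]])
        (use assms in auto)
    show "norm (inverse (G z)) \<le> inverse \<epsilon>" if "z \<in> frontier (cball 0 R)" for z
    proof -
      have "norm (G z) \<ge> \<epsilon>" by (rule assms(5)) (use that in \<open>auto simp: frontier_def\<close>)
      then show ?thesis using \<epsilon> by (simp add: norm_inverse le_imp_inverse_le)
    qed
  qed (use assms in auto)
  moreover have "norm (G 0) > 0" using nz[of 0] assms by simp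
  ultimately show ?thesis using \<epsilon> by (simp add: norm_inverse)
qed

lemma jensen_sum_le:
  assumes hol: "f holomorphic_on UNIV" and f0: "norm (f 0) = 1" and R: "R > 0"
    and bd: "\<And>z. norm z = R \<Longrightarrow> norm (f z) \<le> M"
  shows "jensen_sum f R \<le> ln M"
proof -
  obtain G where G: "G holomorphic_on ball 0 (R + 1)" "\<And>z. norm z < R \<Longrightarrow> G z \<noteq> 0"
    "\<And>z. norm z = R \<Longrightarrow> norm (f z) = norm (G z)" "ln (norm (G 0)) = jensen_sum f R"
    by (rule blaschke_quotient[OF assms(1-3)]) blast
  have "norm (G 0) \<le> M" by (rule circle_maximum[OF G(1) R]) (use G(3) bd R in auto)
  moreover have "norm (G 0) > 0" using G(2)[of 0] R by simp
  ultimately show ?thesis using G(4) by (metis ln_mono)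
qed

text \<open>A lower bound on the whole circle excludes zeros there, so \<open>G\<close> is zero-free
  on the closed disk and the minimum principle reaches its centre. This serves the polynomial
  case.\<close>

lemma jensen_sum_ge_of_circle:
  assumes hol: "f holomorphic_on UNIV" and f0: "norm (f 0) = 1" and R: "R > 0" and \<epsilon>: "\<epsilon> > 0"
    and bd: "\<And>z. norm z = R \<Longrightarrow> \<epsilon> \<le> norm (f z)"
  shows "ln \<epsilon> \<le> jensen_sum f R"
proof -
  obtain G where G: "G holomorphic_on ball 0 (R + 1)" "\<And>z. norm z < R \<Longrightarrow> G z \<noteq> 0"
    "\<And>z. norm z = R \<Longrightarrow> norm (f z) = norm (G z)" "ln (norm (G 0)) = jensen_sum f R"
    by (rule blaschke_quotient[OF assms(1-3)]) blast
  have "G z \<noteq> 0" if "norm z \<le> R" for z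
    using G(2)[of z] G(3)[of z] bd[of z] \<epsilon> that by (cases "norm z = R") auto
  then have "norm (G 0) \<ge> \<epsilon>" by (intro circle_minimum[OF G(1) R]) (use G(3) bd \<epsilon> in auto)
  then show ?thesis using G(4) \<epsilon> by (metis ln_mono)
qed

text \<open>At a net point \<open>c\<close> the lower bound for \<open>f\<close> passes to
  \<open>G\<close>. Harnack's inequality spreads it over the circle of radius \<open>R0\<close> at
  the cost of a cube, and the minimum principle brings it to the origin.\<close>

lemma jensen_sum_ge_of_net:
  assumes hol: "f holomorphic_on UNIV" and f0: "norm (f 0) = 1" and R: "0 < R0" "R0 < R" and \<epsilon>: "\<epsilon> > 0"
    and bd: "\<And>z. norm z \<le> R \<Longrightarrow> norm (f z) < M"
    and net: "\<And>z. norm z = R0 \<Longrightarrow> \<exists>c. norm c = R0 \<and> dist c z \<le> (R - R0) / 2 \<and> \<epsilon> \<le> norm (f c)"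
  shows "ln M - 3 * ln (M / \<epsilon>) \<le> jensen_sum f R"
proof -
  have R0: "R > 0" using R by simp
  obtain G where G: "G holomorphic_on ball 0 (R + 1)" "\<And>z. norm z < R \<Longrightarrow> G z \<noteq> 0"
    "\<And>z. norm z \<le> R \<Longrightarrow> norm (f z) \<le> norm (G z)"
    "\<And>z. norm z = R \<Longrightarrow> norm (f z) = norm (G z)" "ln (norm (G 0)) = jensen_sum f R"
    by (rule blaschke_quotient[OF hol f0 R0]) blast
  have M: "M > 0" using bd[of 0] R0 by (smt (verit) norm_ge_zero norm_zero)
  \<comment> \<open>Since the maximum is attained, the strict bound by \<open>M\<close> is inherited
    by \<open>G\<close>; Harnack's inequality needs it strict.\<close>
  obtain z1 where z1: "norm z1 \<le> R" "\<And>z. norm z \<le> R \<Longrightarrow> norm (f z) \<le> norm (f z1)"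
  proof -
    have "\<exists>x\<in>cball 0 R. \<forall>y\<in>cball 0 R. norm (f y) \<le> norm (f x)"
      by (intro continuous_attains_sup continuous_intros holomorphic_on_imp_continuous_on
           holomorphic_on_subset[OF hol]) (use R0 in auto)
    then show thesis using that by auto
  qed
  have GM: "norm (G z) < M" if "norm z \<le> R" for z
  proof -
    have "norm (G z) \<le> norm (f z1)"
    proof (rule circle_maximum[OF G(1) R0 _ _ that])
      show "norm (G u) \<le> norm (f z1)" if "norm u = R" for u
        using G(4)[OF that] z1(2)[of u] that by simp
    qed simp
    also have "\<dots> < M" by (rule bd[OF z1(1)])
    finally show ?thesis .
  qed
  define \<kappa> where "\<kappa> = M * (\<epsilon> / M) ^ 3"
  have \<kappa>: "\<kappa> > 0" using M \<epsilon> by (simp add: \<kappa>_def)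
  have "norm (G 0) \<ge> \<kappa>"
  proof (rule circle_minimum[OF G(1) R(1) _ _ _ \<kappa>])
    fix z :: complex assume z: "norm z = R0"
    obtain c where c: "norm c = R0" "dist c z \<le> (R - R0) / 2" "\<epsilon> \<le> norm (f c)" using net[OF z] by blast
    have sub: "norm u < R" if "u \<in> ball c (R - R0)" for u
      using that c(1) norm_triangle_ineq2[of u c] by (simp add: dist_norm norm_minus_commute)
    have "(norm (G c) / M) ^ 3 \<le> norm (G z) / M"
    proof (rule harnack_nonvanishing[OF _ _ _ _ c(2)])
      show "G holomorphic_on ball c (R - R0)"
        by (rule holomorphic_on_subset[OF G(1)]) (use sub in force)
      show "R - R0 > 0" using R by simp
      show "G u \<noteq> 0" "norm (G u) < M" if "u \<in> ball c (R - R0)" for u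
        using G(2) GM sub[OF that] by (auto intro: less_imp_le)
    qed
    moreover have "(\<epsilon> / M) ^ 3 \<le> (norm (G c) / M) ^ 3"
      using c G(3)[of c] R \<epsilon> M by (intro power_mono divide_right_mono) auto
    ultimately have "(\<epsilon> / M) ^ 3 \<le> norm (G z) / M" by linarith
    then show "\<kappa> \<le> norm (G z)"
      using M mult_left_mono[of "(\<epsilon> / M) ^ 3" "norm (G z) / M" M] by (simp add: \<kappa>_def)
  qed (use R G in auto)
  then have "ln \<kappa> \<le> jensen_sum f R" using \<kappa> G(5) by (metis ln_mono)
  moreover have "ln \<kappa> = ln M - 3 * ln (M / \<epsilon>)"
    using M \<epsilon> by (simp add: \<kappa>_def ln_mult ln_realpow ln_div)
  ultimately show ?thesis by simp
qed

text \<open>Replacing \<open>g j\<close> by \<open>g (j + 1) - x i * g j\<close> removes the node \<open>x i\<close> from an exponential sum.\<close>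

lemma exponential_sum_coefficient_bound:
  fixes x c :: "'i \<Rightarrow> complex"
  assumes "finite K" "k \<in> K" "card K \<le> p" "d > 0"
    and "\<And>i. i \<in> K \<Longrightarrow> norm (x i) \<le> 1"
    and "\<And>i j. i \<in> K \<Longrightarrow> j \<in> K \<Longrightarrow> i \<noteq> j \<Longrightarrow> d \<le> norm (x i - x j)"
    and "\<And>j. j < p \<Longrightarrow> norm (\<Sum>i\<in>K. c i * x i ^ j) \<le> \<epsilon>"
  shows "norm (c k) \<le> (2 / d) ^ (card K - 1) * \<epsilon>"
  using assms
proof (induction "card K" arbitrary: K p c \<epsilon>)
  case 0
  then show ?case by auto
next
  case (Suc n)
  show ?case
  proof (cases "K = {k}")
    case True
    then show ?thesis using Suc.prems(3) Suc.prems(7)[of 0] by simp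
  next
    case False
    then obtain i where i: "i \<in> K" "i \<noteq> k" using Suc.prems(2) by blast
    define K' where "K' = K - {i}"
    have cK': "card K' = n" using Suc i by (simp add: K'_def)
    have n0: "n \<ge> 1" using cK' Suc.prems i by (metis K'_def One_nat_def Suc_leI card_gt_0_iff finite_Diff insert_Diff insert_iff empty_iff)
    have eq: "(\<Sum>l\<in>K'. c l * (x l - x i) * x l ^ j)
       = (\<Sum>l\<in>K. c l * x l ^ Suc j) - x i * (\<Sum>l\<in>K. c l * x l ^ j)" for j
    proof -
      have "(\<Sum>l\<in>K. c l * x l ^ Suc j) - x i * (\<Sum>l\<in>K. c l * x l ^ j) = (\<Sum>l\<in>K. c l * (x l - x i) * x l ^ j)"
        by (simp add: sum_distrib_left sum_subtractf[symmetric] algebra_simps)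
      also have "\<dots> = (\<Sum>l\<in>K'. c l * (x l - x i) * x l ^ j)"
        unfolding K'_def using Suc.prems(1) i by (subst sum.remove[of K i]) auto
      finally show ?thesis by simp
    qed
    \<comment> \<open>Removing a node costs one sample, doubles the bound for the sums and
      multiplies the coefficient by a factor of modulus at least \<open>d\<close>.\<close>
    have "norm (c k * (x k - x i)) \<le> (2 / d) ^ (card K' - 1) * (2 * \<epsilon>)"
    proof (rule Suc.hyps(1)[of K' "p - 1"])
      show "norm (\<Sum>l\<in>K'. c l * (x l - x i) * x l ^ j) \<le> 2 * \<epsilon>" if "j < p - 1" for j
      proof -
        have 1: "norm (\<Sum>l\<in>K. c l * x l ^ Suc j) \<le> \<epsilon>" by (rule Suc.prems(7)) (use that in simp)
        have 2: "norm (\<Sum>l\<in>K. c l * x l ^ j) \<le> \<epsilon>" by (rule Suc.prems(7)) (use that in simp)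
        have "norm (x i * (\<Sum>l\<in>K. c l * x l ^ j)) \<le> 1 * \<epsilon>"
          unfolding norm_mult by (rule mult_mono) (use Suc.prems(5)[OF i(1)] 2 in auto)
        then show ?thesis unfolding eq
          using 1 norm_triangle_ineq4[of "\<Sum>l\<in>K. c l * x l ^ Suc j" "x i * (\<Sum>l\<in>K. c l * x l ^ j)"] by linarith
      qed
    qed (use Suc.prems Suc.hyps(2) cK' i in \<open>auto simp: K'_def\<close>)
    moreover have "norm (c k) * d \<le> norm (c k * (x k - x i))"
      unfolding norm_mult by (intro mult_left_mono Suc.prems(6)) (use i Suc.prems(2) in auto)
    ultimately have "norm (c k) * d \<le> (2 / d) ^ (n - 1) * (2 * \<epsilon>)" by (simp add: cK')
    then have "norm (c k) \<le> (2 / d) ^ (n - 1) * (2 / d) * \<epsilon>"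
      using \<open>d > 0\<close> by (simp add: field_simps)
    also have "\<dots> = (2 / d) ^ n * \<epsilon>" using n0 by (metis power_minus_mult less_le_trans zero_less_one)
    finally show ?thesis using Suc.hyps(2) by (metis diff_Suc_1)
  qed
qed

section \<open>Separation of roots of unity\<close>

lemma sin_ge_half:
  assumes "0 \<le> x" "x \<le> pi / 3"
  shows "x / 2 \<le> sin x"
proof -
  have "(\<lambda>x. sin x - x / 2) 0 \<le> (\<lambda>x. sin x - x / 2) x"
  proof (rule DERIV_nonneg_imp_nondecreasing[OF assms(1)], intro exI conjI)
    fix u :: real assume u: "0 \<le> u" "u \<le> x"
    show "((\<lambda>x. sin x - x / 2) has_real_derivative cos u - 1/2) (at u)"
      by (auto intro!: derivative_eq_intros)
    have "cos (pi / 3) \<le> cos u" by (rule cos_monotone_0_pi_le) (use u assms in auto)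
    then show "0 \<le> cos u - 1/2" by (simp add: cos_60)
  qed
  then show ?thesis by simp
qed

lemma cis_diff_norm: "norm (cis a - cis b) = 2 * \<bar>sin ((a - b) / 2)\<bar>"
proof (rule power2_eq_imp_eq)
  have "norm (cis a - cis b) ^ 2 = 2 - 2 * cos (a - b)"
    unfolding cmod_power2 using sin_cos_squared_add[of a] sin_cos_squared_add[of b]
    by (simp add: cos_diff power2_eq_square algebra_simps)
  also have "\<dots> = (2 * \<bar>sin ((a - b) / 2)\<bar>) ^ 2"
  proof -
    have "cos (2 * ((a - b) / 2)) = 1 - 2 * (sin ((a - b) / 2))\<^sup>2" by (rule cos_double_sin)
    moreover have "2 * ((a - b) / 2) = a - b" by simp
    ultimately have "cos (a - b) = 1 - 2 * (sin ((a - b) / 2))\<^sup>2" by (simp only:)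
    then show ?thesis by (simp only: power_mult_distrib power2_abs) simp
  qed
  finally show "norm (cis a - cis b) ^ 2 = (2 * \<bar>sin ((a - b) / 2)\<bar>) ^ 2" .
qed auto

text \<open>The chord has length 2 sin y with y between pi / T and pi - pi / T, and on that interval
  the sine is smallest at the ends.\<close>

lemma root_of_unity_separation:
  assumes "k < T" "l < T" "k \<noteq> l"
  shows "2 / real T \<le> norm (cis (2 * pi * real k / real T) - cis (2 * pi * real l / real T))"
proof -
  have T: "T \<ge> 2" using assms by auto
  have *: "2 / real T \<le> norm (cis (2 * pi * real k / real T) - cis (2 * pi * real l / real T))"
    if "l < k" "k < T" for k l
  proof -
    define y where "y = pi * (real k - real l) / real T"
    have kl: "1 \<le> real k - real l" "real k - real l \<le> real T - 1" using that by linarith+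
    have "pi * 1 \<le> pi * (real k - real l)" "pi * (real k - real l) \<le> pi * (real T - 1)"
      by (rule mult_left_mono[OF kl(1)]; simp) (rule mult_left_mono[OF kl(2)]; simp)
    then have "pi * 1 / real T \<le> y" "y \<le> pi * (real T - 1) / real T"
      unfolding y_def by (auto intro!: divide_right_mono)
    moreover have "pi * (real T - 1) / real T = pi - pi / real T" using T by (simp add: field_simps)
    ultimately have y: "pi / real T \<le> y" "y \<le> pi - pi / real T" by simp_all
    \<comment> \<open>For \<open>T = 2\<close> the angle pi / T exceeds pi / 3, where
      \<open>sin_ge_half\<close> stops, but there the sine is 1.\<close>
    have sT: "1 / real T \<le> sin (pi / real T)"
    proof (cases "T = 2")
      case False
      then have "pi / real T \<le> pi / 3" using T by (intro divide_left_mono) auto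
      then have "pi / real T / 2 \<le> sin (pi / real T)" by (intro sin_ge_half) auto
      moreover have "1 / real T \<le> pi / real T / 2" using pi_ge_two T by (simp add: field_simps)
      ultimately show ?thesis by linarith
    qed simp
    have piT: "pi / real T \<le> pi / 2" using T by (intro divide_left_mono) auto
    have p0: "0 < pi / real T" using T by simp
    have "sin (pi / real T) \<le> sin y"
    proof (cases "y \<le> pi / 2")
      case True
      then show ?thesis using y p0 by (intro sin_monotone_2pi_le) auto
    next
      case False
      have "sin (pi / real T) \<le> sin (pi - y)"
        using y p0 False by (intro sin_monotone_2pi_le) auto
      then show ?thesis by simp
    qed
    moreover have "(2 * pi * real k / real T - 2 * pi * real l / real T) / 2 = y"
      by (simp add: y_def algebra_simps diff_divide_distrib)
    ultimately show ?thesis using sT unfolding cis_diff_norm by (simp add: abs_if)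
  qed
  show ?thesis using *[of l k] *[of k l] assms by (metis linorder_neqE_nat norm_minus_commute)
qed

section \<open>The logarithmic derivative of sigma\<close>

locale unit_entire =
  fixes a :: "nat \<Rightarrow> complex"
  assumes conv: "conv_radius a = \<infinity>" and a0: "a 0 = 1"
begin

lemma summable_norm_coeff: "summable (\<lambda>n. norm (a n) * \<bar>r\<bar> ^ n)"
  using abs_summable_in_conv_radius[of "complex_of_real r" a] conv by (simp add: norm_mult norm_power)

lemma summable_square_coeff: "summable (\<lambda>n. (norm (a n))\<^sup>2 * q ^ n)"
proof -
  define r where "r = sqrt \<bar>q\<bar>"
  have "(\<lambda>n. norm (a n) * \<bar>r\<bar> ^ n) \<longlonglongrightarrow> 0" by (rule summable_LIMSEQ_zero[OF summable_norm_coeff])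
  then have "eventually (\<lambda>n. norm (a n) * \<bar>r\<bar> ^ n < 1) sequentially"
    by (rule order_tendstoD) simp
  then have ev: "eventually (\<lambda>n. norm ((norm (a n))\<^sup>2 * q ^ n) \<le> norm (a n) * \<bar>r\<bar> ^ n) sequentially"
  proof eventually_elim
    case (elim n)
    have "\<bar>q\<bar> ^ n = (\<bar>r\<bar> ^ n)\<^sup>2" by (simp add: r_def power_even_eq[symmetric] real_sqrt_power[symmetric] power2_eq_square mult.commute flip: power_mult)
    then have "norm ((norm (a n))\<^sup>2 * q ^ n) = (norm (a n) * \<bar>r\<bar> ^ n) * (norm (a n) * \<bar>r\<bar> ^ n)"
      by (simp add: norm_mult norm_power power_mult_distrib abs_mult power_abs power2_eq_square)
    also have "\<dots> \<le> (norm (a n) * \<bar>r\<bar> ^ n) * 1"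
      by (rule mult_left_mono) (use elim in auto)
    finally show ?case by simp
  qed
  show ?thesis by (rule summable_comparison_test_ev[OF ev summable_norm_coeff])
qed

lemma summable_index_square_coeff: "summable (\<lambda>n. real n * (norm (a n))\<^sup>2 * q ^ n)"
proof -
  have "summable (\<lambda>n. diffs (\<lambda>n. (norm (a n))\<^sup>2) n * q ^ n)"
    by (rule termdiff_converges_all) (rule summable_square_coeff)
  then have "summable (\<lambda>n. q * (diffs (\<lambda>n. (norm (a n))\<^sup>2) n * q ^ n))" by (rule summable_mult)
  then have "summable (\<lambda>n. (\<lambda>n. real n * (norm (a n))\<^sup>2 * q ^ n) (Suc n))"
    by (rule back_subst[where P=summable]) (simp add: diffs_def fun_eq_iff algebra_simps)
  then show ?thesis by (subst (asm) summable_Suc_iff)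
qed

text \<open>In the variable \<open>q = r\<^sup>2\<close>, \<open>sq\<close> is the square of
  \<open>sigma\<close> and \<open>isq\<close> is \<open>q\<close> times the derivative of
  \<open>sq\<close>. Their quotient is \<open>log_deriv_sigma\<close>: the 2 from squaring
  \<open>r\<close> cancels the 1/2 from the square root.\<close>

definition sq where "sq q = (\<Sum>n. (norm (a n))\<^sup>2 * q ^ n)"
definition isq where "isq q = (\<Sum>n. real n * (norm (a n))\<^sup>2 * q ^ n)"

lemma sq_deriv: "(sq has_field_derivative (\<Sum>n. diffs (\<lambda>n. (norm (a n))\<^sup>2) n * q ^ n)) (at q)"
  using termdiffs_strong_converges_everywhere[OF summable_square_coeff] by (simp add: sq_def[abs_def])

lemma isq_eq: "isq q = q * (\<Sum>n. diffs (\<lambda>n. (norm (a n))\<^sup>2) n * q ^ n)"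
proof -
  have s: "summable (\<lambda>n. diffs (\<lambda>n. (norm (a n))\<^sup>2) n * q ^ n)"
    by (rule termdiff_converges_all) (rule summable_square_coeff)
  have "isq q = (\<Sum>n. real (Suc n) * (norm (a (Suc n)))\<^sup>2 * q ^ Suc n)"
    unfolding isq_def by (subst suminf_split_head[OF summable_index_square_coeff]) simp
  also have "\<dots> = (\<Sum>n. q * (diffs (\<lambda>n. (norm (a n))\<^sup>2) n * q ^ n))"
    by (simp add: diffs_def algebra_simps)
  also have "\<dots> = q * (\<Sum>n. diffs (\<lambda>n. (norm (a n))\<^sup>2) n * q ^ n)" by (rule suminf_mult[OF s])
  finally show ?thesis .
qed

lemma isq_cont: "continuous_on S isq"
proof -
  have "((\<lambda>q. \<Sum>n. (real n * (norm (a n))\<^sup>2) * q ^ n) has_field_derivative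
     (\<Sum>n. diffs (\<lambda>n. real n * (norm (a n))\<^sup>2) n * q ^ n)) (at q)" for q
    by (rule termdiffs_strong_converges_everywhere) (rule summable_index_square_coeff)
  then show ?thesis unfolding isq_def[abs_def]
    by (intro continuous_at_imp_continuous_on ballI DERIV_isCont) blast
qed

lemma sq_cont: "continuous_on S sq"
  by (intro continuous_at_imp_continuous_on ballI DERIV_isCont) (rule sq_deriv)

lemma sq_ge_term: "q \<ge> 0 \<Longrightarrow> (norm (a n))\<^sup>2 * q ^ n \<le> sq q"
  unfolding sq_def using sum_le_suminf[OF summable_square_coeff, of "{n}" q] by auto

lemma sq_ge_1: "q \<ge> 0 \<Longrightarrow> sq q \<ge> 1"
  using sq_ge_term[of q 0] a0 by simp

lemma isq_nonneg: "q \<ge> 0 \<Longrightarrow> isq q \<ge> 0"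
  unfolding isq_def by (intro suminf_nonneg summable_index_square_coeff) auto

lemma sigma_eq: "sigma a r = sqrt (sq (r\<^sup>2))"
  by (simp add: sigma_def sq_def power_mult)

lemma sigma_square: "(sigma a r)\<^sup>2 = sq (r\<^sup>2)"
  using sq_ge_1[of "r\<^sup>2"] by (simp add: sigma_eq)

lemma sigma_ge_1: "sigma a r \<ge> 1"
  using sq_ge_1[of "r\<^sup>2"] by (simp add: sigma_eq)

lemma sigma_pos: "sigma a r > 0"
  using sigma_ge_1[of r] by linarith

lemma log_deriv_sigma_eq: "log_deriv_sigma a r = isq (r\<^sup>2) / sq (r\<^sup>2)"
proof -
  let ?D = "\<Sum>n. diffs (\<lambda>n. (norm (a n))\<^sup>2) n * (r\<^sup>2) ^ n"
  have p: "sq (r\<^sup>2) > 0" using sq_ge_1[of "r\<^sup>2"] by simp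
  have "((\<lambda>r. sq (r\<^sup>2)) has_real_derivative ?D * (2 * r)) (at r)"
    by (rule DERIV_chain2[OF sq_deriv]) (auto intro!: derivative_eq_intros)
  then have "((\<lambda>r. sqrt (sq (r\<^sup>2))) has_real_derivative ?D * (2 * r) / (2 * sqrt (sq (r\<^sup>2)))) (at r)"
    using p by (auto intro!: derivative_eq_intros simp: field_simps)
  then have "deriv (sigma a) r = ?D * (2 * r) / (2 * sqrt (sq (r\<^sup>2)))"
    using sigma_eq by (intro DERIV_imp_deriv) (simp add: fun_eq_iff[THEN iffD2, OF allI, OF sigma_eq] sigma_eq[abs_def])
  then have "log_deriv_sigma a r = r * (?D * (2 * r) / (2 * sqrt (sq (r\<^sup>2)))) / sqrt (sq (r\<^sup>2))"
    by (simp add: log_deriv_sigma_def sigma_eq)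
  also have "\<dots> = r\<^sup>2 * ?D / (sqrt (sq (r\<^sup>2)) * sqrt (sq (r\<^sup>2)))"
    by (simp add: power2_eq_square)
  also have "\<dots> = isq (r\<^sup>2) / sq (r\<^sup>2)" using p by (simp add: isq_eq)
  finally show ?thesis .
qed

lemma log_deriv_sigma_nonneg: "log_deriv_sigma a r \<ge> 0"
  unfolding log_deriv_sigma_eq using isq_nonneg[of "r\<^sup>2"] sq_ge_1[of "r\<^sup>2"] by simp

lemma log_deriv_sigma_cont: "continuous_on S (log_deriv_sigma a)"
proof -
  have "continuous_on S (\<lambda>r. isq (r\<^sup>2) / sq (r\<^sup>2))"
  proof (intro continuous_intros continuous_on_compose2[OF isq_cont[of UNIV]]
      continuous_on_compose2[OF sq_cont[of UNIV]] ballI)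
    show "sq (r\<^sup>2) \<noteq> 0" for r using sq_ge_1[of "r\<^sup>2"] by auto
  qed auto
  then show ?thesis by (simp add: log_deriv_sigma_eq[abs_def])
qed

text \<open>Jensen's inequality for the weights \<open>|a\<^sub>n|\<^sup>2 r^(2 n)\<close>, whose mean index is \<open>log_deriv_sigma a r\<close>.\<close>

lemma ln_sigma_increment_ge:
  assumes r: "r > 0" "r' > 0"
  shows "log_deriv_sigma a r * ln (r' / r) \<le> ln (sigma a r') - ln (sigma a r)"
proof -
  define c where "c = log_deriv_sigma a r"
  define t where "t = ln (r' / r)"
  define w where "w = (\<lambda>n. (norm (a n))\<^sup>2 * (r\<^sup>2) ^ n)"
  define X where "X = sq (r\<^sup>2)"
  have X: "X > 0" using sq_ge_1[of "r\<^sup>2"] by (simp add: X_def)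
  have cX: "isq (r\<^sup>2) = c * X" using X by (simp add: c_def log_deriv_sigma_eq X_def)
  have r': "r' = r * exp t" using r by (simp add: t_def)
  have w': "(norm (a n))\<^sup>2 * (r'\<^sup>2) ^ n = w n * exp (2 * real n * t)" for n
    by (simp add: w_def r' power_mult_distrib mult.assoc flip: power_mult exp_of_nat_mult)
  \<comment> \<open>These are the tangent-line minorants of the exponential weights. Because
    \<open>c\<close> is the mean index, their linear parts cancel and the sum is just
    \<open>X\<close>.\<close>
  have sm: "(\<lambda>n. w n * (1 + 2 * (real n - c) * t)) sums (X * (1 - 2 * c * t) + isq (r\<^sup>2) * (2 * t))"
  proof -
    have "(\<lambda>n. w n * (1 - 2 * c * t) + (real n * (norm (a n))\<^sup>2 * (r\<^sup>2) ^ n) * (2 * t))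
      sums (X * (1 - 2 * c * t) + isq (r\<^sup>2) * (2 * t))"
      unfolding X_def sq_def isq_def w_def
      by (intro sums_add sums_mult2 summable_sums summable_square_coeff summable_index_square_coeff)
    then show ?thesis by (simp add: w_def algebra_simps)
  qed
  have "X * (1 - 2 * c * t) + isq (r\<^sup>2) * (2 * t) \<le> sq (r'\<^sup>2) * exp (- 2 * c * t)"
  proof (rule sums_le[OF _ sm])
    show "(\<lambda>n. (norm (a n))\<^sup>2 * (r'\<^sup>2) ^ n * exp (- 2 * c * t)) sums (sq (r'\<^sup>2) * exp (- 2 * c * t))"
      unfolding sq_def by (intro sums_mult2 summable_sums summable_square_coeff)
    fix n
    have "w n * (1 + 2 * (real n - c) * t) \<le> w n * exp (2 * (real n - c) * t)"
      by (intro mult_left_mono exp_ge_add_one_self) (auto simp: w_def)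
    also have "\<dots> = (norm (a n))\<^sup>2 * (r'\<^sup>2) ^ n * exp (- 2 * c * t)"
      by (simp add: w' exp_add[symmetric] algebra_simps)
    finally show "w n * (1 + 2 * (real n - c) * t) \<le> (norm (a n))\<^sup>2 * (r'\<^sup>2) ^ n * exp (- 2 * c * t)" .
  qed
  then have "X \<le> sq (r'\<^sup>2) * exp (- 2 * c * t)" unfolding cX by (simp add: algebra_simps)
  then have "ln X \<le> ln (sq (r'\<^sup>2) * exp (- 2 * c * t))" using X by simp
  also have "\<dots> = ln (sq (r'\<^sup>2)) - 2 * c * t"
    using sq_ge_1[of "r'\<^sup>2"] by (simp add: ln_mult)
  finally have "2 * (c * t) \<le> ln (sq (r'\<^sup>2)) - ln (sq (r\<^sup>2))" by (simp add: X_def)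
  moreover have ls: "ln (sigma a u) = ln (sq (u\<^sup>2)) / 2" for u
    using sq_ge_1[of "u\<^sup>2"] by (simp add: sigma_eq ln_sqrt)
  ultimately show ?thesis unfolding ls c_def t_def by linarith
qed

lemma ln_sigma_increment_le:
  assumes "r > 0" "r' > 0"
  shows "ln (sigma a r') - ln (sigma a r) \<le> log_deriv_sigma a r' * ln (r' / r)"
  using ln_sigma_increment_ge[OF assms(2,1)] assms by (simp add: ln_div algebra_simps)

lemma log_deriv_sigma_mono:
  assumes "0 < r" "r \<le> r'"
  shows "log_deriv_sigma a r \<le> log_deriv_sigma a r'"
proof (cases "r = r'")
  case False
  have "log_deriv_sigma a r * ln (r' / r) \<le> log_deriv_sigma a r' * ln (r' / r)"
    using ln_sigma_increment_ge[of r r'] ln_sigma_increment_le[of r r'] assms by linarith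
  moreover have "ln (r' / r) > 0" using assms False by simp
  ultimately show ?thesis by simp
qed simp

lemma sigma_mono:
  assumes "0 < r" "r \<le> r'"
  shows "sigma a r \<le> sigma a r'"
proof -
  have "0 \<le> log_deriv_sigma a r * ln (r' / r)"
    using assms log_deriv_sigma_nonneg by (intro mult_nonneg_nonneg) auto
  then have "ln (sigma a r) \<le> ln (sigma a r')" using ln_sigma_increment_ge[of r r'] assms by linarith
  then show ?thesis using sigma_pos by simp
qed

text \<open>A bound \<open>c\<close> on the logarithmic derivative would limit \<open>sigma\<close>
  to growth of order r^c, but a nonzero coefficient of index above \<open>c\<close> forces faster
  growth.\<close>

lemma log_deriv_sigma_unbounded:
  assumes inf: "\<And>N. \<exists>n\<ge>N. a n \<noteq> 0"
  shows "\<exists>r\<ge>1. log_deriv_sigma a r > c"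
proof (rule ccontr)
  assume "\<not> ?thesis"
  then have le: "log_deriv_sigma a r \<le> c" if "r \<ge> 1" for r using that by force
  obtain n where n: "n \<ge> nat \<lceil>c\<rceil> + 1" "a n \<noteq> 0" using inf by blast
  have "real n \<ge> c + 1" using n(1) by linarith
  have bd: "(real n - c) * t \<le> ln (sigma a 1) - ln (norm (a n))" if t: "t \<ge> 0" for t
  proof -
    have "((norm (a n)) * (exp t) ^ n)\<^sup>2 \<le> (sigma a (exp t))\<^sup>2"
      using sq_ge_term[of "(exp t)\<^sup>2" n] by (simp add: sigma_square power_mult_distrib power_mult[symmetric] mult.commute)
    then have "norm (a n) * (exp t) ^ n \<le> sigma a (exp t)"
      by (rule power2_le_imp_le) (use sigma_pos less_imp_le in blast)
    then have "ln (norm (a n) * (exp t) ^ n) \<le> ln (sigma a (exp t))" using n(2) by (intro ln_mono) auto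
    then have "ln (norm (a n)) + real n * t \<le> ln (sigma a (exp t))"
      using n(2) by (simp add: ln_mult ln_realpow)
    also have "\<dots> \<le> ln (sigma a 1) + log_deriv_sigma a (exp t) * t"
      using ln_sigma_increment_le[of 1 "exp t"] by simp
    also have "\<dots> \<le> ln (sigma a 1) + c * t" using le[of "exp t"] t by (intro add_left_mono mult_right_mono) auto
    finally show ?thesis by (simp add: algebra_simps)
  qed
  \<comment> \<open>One more than the modulus of the right side of \<open>bd\<close>, whose left
    side is at least \<open>t\<close>.\<close>
  define t where "t = \<bar>ln (sigma a 1) - ln (norm (a n))\<bar> + 1"
  have "1 * t \<le> (real n - c) * t" using \<open>real n \<ge> c + 1\<close> by (intro mult_right_mono) (auto simp: t_def)
  then show False using bd[of t] by (simp add: t_def)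
qed

end

section \<open>Size of the signed series\<close>

text \<open>The analytic estimates see the random signs only through this property, so they hold for
  every outcome.\<close>

definition sign_seq :: "(nat \<Rightarrow> real) \<Rightarrow> bool" where
  "sign_seq x \<longleftrightarrow> (\<forall>n. \<bar>x n\<bar> = 1)"

lemma cis_lipschitz: "norm (cis a - cis b) \<le> \<bar>a - b\<bar>"
  using abs_sin_x_le_abs_x[of "(a - b) / 2"] by (simp add: cis_diff_norm)

context unit_entire
begin

lemma summable_coeff: "r \<ge> 0 \<Longrightarrow> summable (\<lambda>n. norm (a n) * r ^ n)"
  using summable_norm_coeff[of r] by simp

lemma signed_series_sums:
  assumes "sign_seq x"
  shows "(\<lambda>n. a n * of_real (x n) * z ^ n) sums signed_series a x z"
proof -
  have "summable (\<lambda>n. norm (a n * of_real (x n) * z ^ n))"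
    using summable_coeff[of "norm z"] assms by (simp add: norm_mult norm_power sign_seq_def)
  then show ?thesis unfolding signed_series_def by (rule summable_sums[OF summable_norm_cancel])
qed

lemma signed_series_holomorphic:
  assumes "sign_seq x"
  shows "signed_series a x holomorphic_on UNIV"
proof -
  have "signed_series a x holomorphic_on ball 0 r" for r
    by (rule power_series_holomorphic[where a = "\<lambda>n. a n * of_real (x n)"])
      (use signed_series_sums[OF assms] in simp)
  then have "signed_series a x field_differentiable at z" for z
    using holomorphic_on_imp_differentiable_at[OF _ open_ball, of _ 0 "norm z + 1" z] by simp
  then show ?thesis by (simp add: holomorphic_on_def field_differentiable_at_within)
qed

lemma signed_series_0: "signed_series a x 0 = of_real (x 0)"
proof -
  have "(\<lambda>n. a n * of_real (x n) * 0 ^ n) sums (a 0 * of_real (x 0))"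
    by (rule powser_sums_zero[of "\<lambda>n. a n * of_real (x n)"])
  then show ?thesis unfolding signed_series_def by (simp add: sums_iff a0)
qed

lemma norm_signed_series_0: "sign_seq x \<Longrightarrow> norm (signed_series a x 0) = 1"
  by (simp add: signed_series_0 sign_seq_def)

definition majorant where "majorant r = (\<Sum>n. norm (a n) * r ^ n)"

lemma norm_signed_series_le:
  assumes x: "sign_seq x" and z: "norm z \<le> r"
  shows "norm (signed_series a x z) \<le> majorant r"
proof -
  have r: "r \<ge> 0" using z norm_ge_zero order_trans by blast
  have "norm (\<Sum>n. a n * of_real (x n) * z ^ n) \<le> (\<Sum>n. norm (a n) * r ^ n)"
    by (rule norm_suminf_le[OF _ summable_coeff[OF r]])
      (use x z in \<open>auto simp: norm_mult norm_power sign_seq_def intro!: mult_left_mono power_mono\<close>)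
  then show ?thesis by (simp add: signed_series_def majorant_def)
qed

lemma signed_series_split:
  assumes x: "sign_seq x"
  shows "norm (signed_series a x z - (\<Sum>n<T. a n * of_real (x n) * z ^ n)) \<le> (\<Sum>n. norm (a (n + T)) * norm z ^ (n + T))"
proof -
  have s: "summable (\<lambda>n. a n * of_real (x n) * z ^ n)" using signed_series_sums[OF x] by (rule sums_summable)
  have "norm (\<Sum>n. a (n + T) * of_real (x (n + T)) * z ^ (n + T)) \<le> (\<Sum>n. norm (a (n + T)) * norm z ^ (n + T))"
    by (rule norm_suminf_le[OF _ summable_ignore_initial_segment[OF summable_coeff[OF norm_ge_zero]]])
      (use x in \<open>auto simp: norm_mult norm_power sign_seq_def\<close>)
  then show ?thesis unfolding signed_series_def suminf_minus_initial_segment[OF s] .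
qed

text \<open>Cauchy-Schwarz against the geometric weights \<open>q ^ n\<close>: enlarging the radius
  by \<open>exp (1 / m)\<close> pays for passing from the absolute sum to the square sum.\<close>

lemma majorant_le_sigma:
  assumes m: "m \<ge> 2" and R: "R > 0"
  shows "majorant R \<le> sigma a (R * exp (1 / m)) * sqrt m"
proof -
  define q where "q = exp (- (1 / m))"
  define u where "u = (\<lambda>n. norm (a n) * (R * exp (1 / m)) ^ n)"
  have q: "0 < q" "q < 1" using m by (simp_all add: q_def)
  \<comment> \<open>The last comparison, m / (m + 2) \<le> 1 - 1 / m, is equivalent to
    \<open>m \<ge> 2\<close>.\<close>
  have q2: "1 / (1 - q\<^sup>2) \<le> m"
  proof -
    have "1 + 2 / m \<le> exp (2 / m)" by (rule exp_ge_add_one_self)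
    moreover have "exp (2 / m) * q\<^sup>2 = 1"
      by (simp add: q_def power2_eq_square exp_add[symmetric])
    ultimately have "(1 + 2 / m) * q\<^sup>2 \<le> 1" using mult_right_mono[of "1 + 2 / m" "exp (2 / m)" "q\<^sup>2"] by simp
    then have "q\<^sup>2 \<le> m / (m + 2)" using m by (simp add: field_simps)
    also have "\<dots> \<le> 1 - 1 / m" using m by (simp add: field_simps)
    finally have "1 / m \<le> 1 - q\<^sup>2" by simp
    moreover have "0 < 1 / m" using m by simp
    ultimately have "1 / (1 - q\<^sup>2) \<le> 1 / (1 / m)" using m using q by (intro divide_left_mono) (auto intro!: divide_pos_pos simp: abs_square_less_1)
    then show ?thesis by simp
  qed
  have "norm (a n) * R ^ n = u n * q ^ n" for n
  proof -
    have "exp (1 / m) * q = 1" by (simp add: q_def flip: exp_add)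
    then have "(R * exp (1 / m)) ^ n * q ^ n = R ^ n"
      by (metis mult.assoc mult.right_neutral power_mult_distrib)
    then show ?thesis by (simp add: u_def)
  qed
  have su: "summable (\<lambda>n. (u n)\<^sup>2)" "(\<Sum>n. (u n)\<^sup>2) = (sigma a (R * exp (1 / m)))\<^sup>2"
  proof -
    have e: "(u n)\<^sup>2 = (norm (a n))\<^sup>2 * ((R * exp (1 / m))\<^sup>2) ^ n" for n
      unfolding u_def by (simp only: power_mult_distrib) (simp only: power_mult[symmetric] mult.commute)
    show "summable (\<lambda>n. (u n)\<^sup>2)" "(\<Sum>n. (u n)\<^sup>2) = (sigma a (R * exp (1 / m)))\<^sup>2"
      unfolding e sigma_square sq_def by (rule summable_square_coeff) simp
  qed
  show ?thesis unfolding majorant_def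
  proof (rule suminf_le_const[OF summable_coeff])
    fix N
    have "(\<Sum>n<N. u n * q ^ n)\<^sup>2 \<le> (\<Sum>n<N. (u n)\<^sup>2) * (\<Sum>n<N. (q ^ n)\<^sup>2)" by (rule Cauchy_Schwarz_ineq_sum)
    also have "\<dots> \<le> (sigma a (R * exp (1 / m)))\<^sup>2 * m"
    proof (rule mult_mono)
      show "(\<Sum>n<N. (u n)\<^sup>2) \<le> (sigma a (R * exp (1 / m)))\<^sup>2"
        unfolding su(2)[symmetric] by (rule sum_le_suminf[OF su(1)]) auto
      have q2': "norm (q\<^sup>2) < 1" using q by (simp add: abs_square_less_1)
      have "(\<Sum>n<N. (q\<^sup>2) ^ n) \<le> (\<Sum>n. (q\<^sup>2) ^ n)"
        by (rule sum_le_suminf[OF summable_geometric[OF q2']]) auto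
      also have "\<dots> = 1 / (1 - q\<^sup>2)" by (rule suminf_geometric[OF q2'])
      finally show "(\<Sum>n<N. (q ^ n)\<^sup>2) \<le> m" using q2 by (simp add: power_mult[symmetric] mult.commute)
    qed (auto intro: sum_nonneg)
    also have "\<dots> = (sigma a (R * exp (1 / m)) * sqrt m)\<^sup>2" using m by (simp add: power_mult_distrib)
    finally have "(\<Sum>n<N. u n * q ^ n) \<le> sigma a (R * exp (1 / m)) * sqrt m"
      by (rule power2_le_imp_le) (use m sigma_pos[of "R * exp (1 / m)"] in simp)
    then show "(\<Sum>n<N. norm (a n) * R ^ n) \<le> sigma a (R * exp (1 / m)) * sqrt m"
      using \<open>\<And>n. norm (a n) * R ^ n = u n * q ^ n\<close> by simp
  qed (use R in auto)
qed

end

section \<open>Small values on a net of the circle\<close>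

lemma circle_net:
  assumes z: "norm z = R" and T: "T > (0::nat)"
  shows "\<exists>k<T. dist (of_real R * cis (2 * pi * real k / real T)) z \<le> R * (2 * pi / real T)"
proof -
  have R: "R \<ge> 0" using z norm_ge_zero by blast
  obtain \<theta> where \<theta>: "0 \<le> \<theta>" "\<theta> < 2 * pi" "z = of_real R * cis \<theta>"
    using Arg2pi[of z] z unfolding is_Arg_def cis_conv_exp by metis
  define y where "y = \<theta> * real T / (2 * pi)"
  define k where "k = nat \<lfloor>y\<rfloor>"
  have y0: "y \<ge> 0" using \<theta> by (simp add: y_def)
  have k: "real k \<le> y" "y < real k + 1" using y0 unfolding k_def by linarith+
  have "y < real T" using \<theta> T by (simp add: y_def field_simps)
  then have "k < T" using k by linarith
  have "\<bar>2 * pi * real k / real T - \<theta>\<bar> = 2 * pi / real T * \<bar>real k - y\<bar>"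
  proof -
    have "2 * pi * real k / real T - \<theta> = 2 * pi / real T * (real k - y)" using T by (simp add: y_def field_simps)
    then show ?thesis by (simp add: abs_mult)
  qed
  also have "\<dots> \<le> 2 * pi / real T * 1" using k by (intro mult_left_mono) auto
  finally have le: "\<bar>2 * pi * real k / real T - \<theta>\<bar> \<le> 2 * pi / real T" by simp
  have "dist (of_real R * cis (2 * pi * real k / real T)) z = R * norm (cis (2 * pi * real k / real T) - cis \<theta>)"
    using R by (simp add: \<theta>(3) dist_norm norm_mult flip: right_diff_distrib)
  also have "\<dots> \<le> R * (2 * pi / real T)"
    using cis_lipschitz[of "2 * pi * real k / real T" \<theta>] le R by (intro mult_left_mono) auto
  finally show ?thesis using \<open>k < T\<close> by blast
qed

section \<open>Equally spaced points on a circle\<close>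

definition circle_pt :: "real \<Rightarrow> nat \<Rightarrow> nat \<Rightarrow> complex" where
  "circle_pt R T k = of_real R * cis (2 * pi * real k / real T)"

lemma norm_circle_pt: "R \<ge> 0 \<Longrightarrow> norm (circle_pt R T k) = R"
  by (simp add: circle_pt_def norm_mult)

lemma dist_circle_pt_add:
  assumes "R \<ge> 0"
  shows "dist (circle_pt R T (l + j)) (circle_pt R T l) \<le> R * (2 * pi * real j / real T)"
proof -
  have "dist (circle_pt R T (l + j)) (circle_pt R T l)
     = R * norm (cis (2 * pi * real (l + j) / real T) - cis (2 * pi * real l / real T))"
    using assms by (simp add: circle_pt_def dist_norm norm_mult flip: right_diff_distrib)
  also have "\<dots> \<le> R * \<bar>2 * pi * real (l + j) / real T - 2 * pi * real l / real T\<bar>"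
    by (intro mult_left_mono cis_lipschitz assms)
  also have "2 * pi * real (l + j) / real T - 2 * pi * real l / real T = 2 * pi * real j / real T"
    by (simp add: add_divide_distrib algebra_simps)
  finally show ?thesis by simp
qed

text \<open>Sampled at consecutive points, the monomial of degree \<open>n\<close> is a constant
  times the \<open>j\<close>-th power of a root of unity determined by \<open>n\<close>. So the
  samples form an exponential sum in \<open>j\<close>, with nodes distinct for degrees below
  \<open>T\<close>, and the separation 2 / T turns the factor \<open>2 / d\<close> into
  \<open>T\<close>.\<close>

lemma coefficient_le_circle_values:
  assumes K: "finite K" "K \<subseteq> {..<T}" "k \<in> K" "card K \<le> p" and R: "R \<ge> 0"
    and le: "\<And>j. j < p \<Longrightarrow> norm (\<Sum>n\<in>K. c n * circle_pt R T (l + j) ^ n) \<le> \<epsilon>"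
  shows "norm (c k) * R ^ k \<le> real T ^ p * \<epsilon>"
proof -
  have T: "T > 0" using K by auto
  have p: "p > 0" using K card_gt_0_iff[of K] by force
  \<comment> \<open>The roles of degree and sample index are interchanged: \<open>n\<close> becomes
    the node and \<open>j\<close> the exponent.\<close>
  have eq: "circle_pt R T (l + j) ^ n = of_real R ^ n * cis (2 * pi * real l / real T) ^ n * cis (2 * pi * real n / real T) ^ j" for j n
  proof -
    have "cis (2 * pi * real (l + j) / real T) = cis (2 * pi * real l / real T) * cis (2 * pi * real j / real T)"
      by (simp add: cis_mult add_divide_distrib distrib_left)
    moreover have "cis (2 * pi * real j / real T) ^ n = cis (2 * pi * real n / real T) ^ j"
    proof -
      have "real n * (2 * pi * real j / real T) = real j * (2 * pi * real n / real T)" by simp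
      then show ?thesis unfolding Complex.DeMoivre by (rule arg_cong)
    qed
    ultimately show ?thesis by (simp add: circle_pt_def power_mult_distrib)
  qed
  have "norm (c k * (of_real R ^ k * cis (2 * pi * real l / real T) ^ k)) \<le> (2 / (2 / real T)) ^ (card K - 1) * \<epsilon>"
  proof (rule exponential_sum_coefficient_bound[where x = "\<lambda>n. cis (2 * pi * real n / real T)" and p = p])
    show "norm (\<Sum>n\<in>K. c n * (of_real R ^ n * cis (2 * pi * real l / real T) ^ n) * cis (2 * pi * real n / real T) ^ j) \<le> \<epsilon>"
      if "j < p" for j using le[OF that] by (simp add: eq mult.assoc)
    show "2 / real T \<le> norm (cis (2 * pi * real i / real T) - cis (2 * pi * real j / real T))"
      if "i \<in> K" "j \<in> K" "i \<noteq> j" for i j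
      using that K by (intro root_of_unity_separation) auto
  qed (use K T in auto)
  also have "\<dots> \<le> real T ^ p * \<epsilon>"
  proof (rule mult_right_mono)
    have "real T ^ (card K - 1) \<le> real T ^ p" using T K by (intro power_increasing) auto
    then show "(2 / (2 / real T)) ^ (card K - 1) \<le> real T ^ p" by simp
    show "0 \<le> \<epsilon>" using le[OF p] norm_ge_zero order_trans by blast
  qed
  finally show ?thesis using R by (simp add: norm_mult norm_power)
qed

definition net_params :: "nat \<Rightarrow> nat \<Rightarrow> bool" where
  "net_params m p \<longleftrightarrow> m \<ge> 2 \<and> 2 * pi * (1 + real p) / (real m)\<^sup>2 \<le> 1 / (2 * real m) \<and>
    ((real m)\<^sup>2) ^ p * (1 / real m ^ (4 * p + 5) + (real m)\<^sup>2 * (1 / real m ^ (2 * p + 4)) + exp 2 * sqrt (real m) * exp (- real m))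
      < 1 / (2 * real m)"

locale test_circle = unit_entire +
  fixes m p :: nat and R :: real
  assumes R: "R > 0" and params: "net_params m p"
    and ld: "log_deriv_sigma a (R * exp (1 / real m)) \<le> real m"
begin

text \<open>Coefficients with index at least \<open>T = m\<^sup>2\<close> are suppressed by a factor \<open>e\<^bsup>-m\<^esup>\<close> when passing from \<open>R\<close>
  to \<open>R0\<close>. Reading off a coefficient from \<open>p\<close> values costs a factor \<open>T\<^bsup>p\<^esup> = m\<^bsup>2p\<^esup>\<close>: \<open>\<eta>\<close> is so small that after
  this loss the \<open>T\<close> coefficients below \<open>\<eta> * \<sigma>0\<close> remain negligible, and \<open>\<delta>\<close> that \<open>T\<^bsup>p\<^esup> * \<delta> < \<eta>\<close>.\<close>

definition "R0 = R * exp (- (1 / real m))"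
definition "\<sigma>0 = sigma a R0"
definition "\<delta> = 1 / real m ^ (4 * p + 5)"
definition "\<eta> = 1 / real m ^ (2 * p + 4)"
definition "Q = exp 2 * sqrt (real m)"
definition "T = m\<^sup>2"

lemma m2: "real m \<ge> 2" "m \<ge> 2"
  using params by (auto simp: net_params_def)

lemma T_pos: "T > 0" using m2 by (simp add: T_def)

lemma R0_pos: "R0 > 0" using R by (simp add: R0_def)

lemma \<sigma>0_pos: "\<sigma>0 > 0" by (simp add: \<sigma>0_def sigma_pos)

text \<open>The two radii are at logarithmic distance 2 / m and the slope of
  \<open>ln (sigma a r)\<close> there is at most \<open>m\<close>, so the logarithm grows by at most
  2.\<close>

lemma sigma_ratio: "sigma a (R * exp (1 / real m)) \<le> exp 2 * \<sigma>0"
proof -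
  have "ln (sigma a (R * exp (1 / real m))) - ln \<sigma>0 \<le> log_deriv_sigma a (R * exp (1 / real m)) * ln (R * exp (1 / real m) / R0)"
    unfolding \<sigma>0_def using R R0_pos by (intro ln_sigma_increment_le) auto
  also have "ln (R * exp (1 / real m) / R0) = 2 / real m"
    using R by (simp add: R0_def exp_minus field_simps ln_mult flip: exp_add)
  also have "log_deriv_sigma a (R * exp (1 / real m)) * (2 / real m) \<le> real m * (2 / real m)"
    by (intro mult_right_mono ld) auto
  finally have "ln (sigma a (R * exp (1 / real m))) \<le> ln (exp 2 * \<sigma>0)"
    using m2 \<sigma>0_pos by (simp add: ln_mult)
  then show ?thesis using sigma_pos \<sigma>0_pos by simp
qed

lemma majorant_le: "majorant R \<le> Q * \<sigma>0"
proof -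
  have "majorant R \<le> sigma a (R * exp (1 / real m)) * sqrt (real m)"
    by (rule majorant_le_sigma[OF _ R]) (use m2 in auto)
  also have "\<dots> \<le> exp 2 * \<sigma>0 * sqrt (real m)" by (intro mult_right_mono sigma_ratio) auto
  finally show ?thesis by (simp add: Q_def mult_ac)
qed

lemma sigma_R_bounds: "\<sigma>0 \<le> sigma a R" "ln (sigma a R) \<le> ln \<sigma>0 + 2"
proof -
  have "R0 \<le> R" "R \<le> R * exp (1 / real m)" using R by (auto simp: R0_def)
  then show "\<sigma>0 \<le> sigma a R" unfolding \<sigma>0_def by (intro sigma_mono R0_pos)
  have "sigma a R \<le> sigma a (R * exp (1 / real m))" using R by (intro sigma_mono) auto
  then have "sigma a R \<le> exp 2 * \<sigma>0" using sigma_ratio by linarith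
  then have "ln (sigma a R) \<le> ln (exp 2 * \<sigma>0)" using sigma_pos by (intro ln_mono) auto
  then show "ln (sigma a R) \<le> ln \<sigma>0 + 2" using \<sigma>0_pos by (simp add: ln_mult)
qed

lemma tail_le: "(\<Sum>n. norm (a (n + T)) * R0 ^ (n + T)) \<le> Q * exp (- real m) * \<sigma>0"
proof -
  have "(\<Sum>n. norm (a (n + T)) * R0 ^ (n + T)) \<le> (\<Sum>n. exp (- real m) * (norm (a (n + T)) * R ^ (n + T)))"
  proof (rule suminf_le)
    fix n
    have "R0 ^ (n + T) = R ^ (n + T) * exp (- (real (n + T) / real m))"
      by (simp add: R0_def power_mult_distrib flip: exp_of_nat_mult)
    also have "\<dots> \<le> R ^ (n + T) * exp (- real m)"
    proof (intro mult_left_mono)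
      have "real m \<le> real (n + T) / real m" using m2 by (simp add: T_def field_simps power2_eq_square)
      then show "exp (- (real (n + T) / real m)) \<le> exp (- real m)" by simp
    qed (use R in auto)
    finally have "norm (a (n + T)) * R0 ^ (n + T) \<le> norm (a (n + T)) * (R ^ (n + T) * exp (- real m))"
      by (rule mult_left_mono) simp
    then show "norm (a (n + T)) * R0 ^ (n + T) \<le> exp (- real m) * (norm (a (n + T)) * R ^ (n + T))"
      by (simp add: mult_ac)
  qed (use R R0_pos in \<open>auto intro!: summable_mult summable_ignore_initial_segment[OF summable_coeff]\<close>)
  also have "\<dots> = exp (- real m) * (\<Sum>n. norm (a (n + T)) * R ^ (n + T))"
    using R by (intro suminf_mult summable_ignore_initial_segment[OF summable_coeff]) auto
  also have "\<dots> \<le> exp (- real m) * (Q * \<sigma>0)"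
  proof (intro mult_left_mono)
    have s: "summable (\<lambda>n. norm (a n) * R ^ n)" using R by (intro summable_coeff) auto
    have "(\<Sum>n. norm (a (n + T)) * R ^ (n + T)) = majorant R - (\<Sum>n<T. norm (a n) * R ^ n)"
      unfolding majorant_def by (rule suminf_minus_initial_segment[OF s])
    also have "\<dots> \<le> majorant R" using R by (simp add: sum_nonneg)
    finally show "(\<Sum>n. norm (a (n + T)) * R ^ (n + T)) \<le> Q * \<sigma>0" using majorant_le by linarith
  qed auto
  finally show ?thesis by (simp add: mult_ac)
qed

text \<open>Otherwise the \<open>T = m\<^sup>2\<close> initial terms would contribute at most a
  quarter of \<open>\<sigma>0\<^sup>2\<close>, and the tail contributes at most a half.\<close>

lemma large_coefficient: "\<exists>n<T. \<sigma>0 / (2 * real m) \<le> norm (a n) * R0 ^ n"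
proof (rule ccontr)
  assume "\<not> ?thesis"
  then have small: "norm (a n) * R0 ^ n < \<sigma>0 / (2 * real m)" if "n < T" for n using that by force
  define b where "b = (\<lambda>n. (norm (a n))\<^sup>2 * (R0\<^sup>2) ^ n)"
  have b: "b n = (norm (a n) * R0 ^ n)\<^sup>2" for n
    unfolding b_def by (simp add: power_mult_distrib mult.commute flip: power_mult)
  have sb: "summable b" unfolding b_def by (rule summable_square_coeff)
  have tot: "\<sigma>0\<^sup>2 = (\<Sum>n. b (n + T)) + (\<Sum>n<T. b n)"
    unfolding \<sigma>0_def sigma_square sq_def using suminf_split_initial_segment[OF sb, of T] by (simp add: b_def)
  have "(\<Sum>n<T. b n) \<le> (\<Sum>n<T. (\<sigma>0 / (2 * real m))\<^sup>2)"
    unfolding b using small R0_pos by (intro sum_mono power_mono) (auto intro: less_imp_le)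
  also have "\<dots> = \<sigma>0\<^sup>2 / 4" using m2 by (simp add: T_def power_divide power_mult_distrib)
  finally have 1: "(\<Sum>n<T. b n) \<le> \<sigma>0\<^sup>2 / 4" .
  \<comment> \<open>From \<open>R2\<close> down to \<open>R0\<close> each squared tail term loses a
    factor \<open>exp (- 4 * real m)\<close>, while the square of \<open>sigma\<close> changes only
    by a factor of at most \<open>exp 4\<close>.\<close>
  define R2 where "R2 = R * exp (1 / real m)"
  have s2: "summable (\<lambda>n. (norm (a n))\<^sup>2 * (R2\<^sup>2) ^ n)" by (rule summable_square_coeff)
  have "(\<Sum>n. b (n + T)) \<le> (\<Sum>n. exp (- 4 * real m) * ((norm (a (n + T)))\<^sup>2 * (R2\<^sup>2) ^ (n + T)))"
  proof (rule suminf_le)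
    fix n
    have "R0 = R2 * exp (- (2 / real m))" by (simp add: R0_def R2_def mult.assoc flip: exp_add)
    then have "(R0\<^sup>2) ^ (n + T) = (R2\<^sup>2) ^ (n + T) * exp (- (4 * (real (n + T) / real m)))"
      by (simp add: power_mult_distrib flip: exp_of_nat_mult power_mult)
    also have "\<dots> \<le> (R2\<^sup>2) ^ (n + T) * exp (- 4 * real m)"
    proof (intro mult_left_mono)
      have "real m \<le> real (n + T) / real m" using m2 by (simp add: T_def field_simps power2_eq_square)
      then show "exp (- (4 * (real (n + T) / real m))) \<le> exp (- 4 * real m)"
        unfolding exp_le_cancel_iff by linarith
    qed auto
    finally have "b (n + T) \<le> (norm (a (n + T)))\<^sup>2 * ((R2\<^sup>2) ^ (n + T) * exp (- 4 * real m))"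
      unfolding b_def by (rule mult_left_mono) simp
    then show "b (n + T) \<le> exp (- 4 * real m) * ((norm (a (n + T)))\<^sup>2 * (R2\<^sup>2) ^ (n + T))"
      by (simp add: mult_ac)
  qed (intro summable_mult summable_ignore_initial_segment[OF sb] summable_ignore_initial_segment[OF s2])+
  also have "\<dots> = exp (- 4 * real m) * (\<Sum>n. (norm (a (n + T)))\<^sup>2 * (R2\<^sup>2) ^ (n + T))"
    by (intro suminf_mult summable_ignore_initial_segment[OF s2])
  also have "\<dots> \<le> exp (- 4 * real m) * (exp 2 * \<sigma>0)\<^sup>2"
  proof (intro mult_left_mono)
    have "(\<Sum>n. (norm (a (n + T)))\<^sup>2 * (R2\<^sup>2) ^ (n + T)) = (sigma a R2)\<^sup>2 - (\<Sum>n<T. (norm (a n))\<^sup>2 * (R2\<^sup>2) ^ n)"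
      unfolding sigma_square sq_def by (rule suminf_minus_initial_segment[OF s2])
    also have "\<dots> \<le> (sigma a R2)\<^sup>2" by (simp add: sum_nonneg)
    also have "\<dots> \<le> (exp 2 * \<sigma>0)\<^sup>2" using sigma_ratio sigma_pos[of R2] by (intro power_mono) (auto simp: R2_def)
    finally show "(\<Sum>n. (norm (a (n + T)))\<^sup>2 * (R2\<^sup>2) ^ (n + T)) \<le> (exp 2 * \<sigma>0)\<^sup>2" .
  qed auto
  also have "\<dots> = exp (4 - 4 * real m) * \<sigma>0\<^sup>2"
    by (simp add: power_mult_distrib power2_eq_square exp_diff exp_minus field_simps flip: exp_add)
  also have "\<dots> \<le> 1 / 2 * \<sigma>0\<^sup>2"
  proof (intro mult_right_mono)
    have "exp (4 - 4 * real m) \<le> exp (- 1)" using m2 by simp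
    also have "exp (- 1) \<le> (1 / 2 :: real)" using exp_ge_add_one_self[of "1::real"] by (simp add: exp_minus field_simps)
    finally show "exp (4 - 4 * real m) \<le> 1 / 2" .
  qed auto
  finally have "\<sigma>0\<^sup>2 \<le> 3 / 4 * \<sigma>0\<^sup>2" using tot 1 by simp
  then show False using \<sigma>0_pos by simp
qed

text \<open>The index \<open>l + j\<close> may pass \<open>T\<close>; \<open>circle_pt\<close> has
  period \<open>T\<close> in it, so the arc wraps around the circle.\<close>

definition flat :: "nat \<Rightarrow> (nat \<Rightarrow> real) \<Rightarrow> bool" where
  "flat l x \<longleftrightarrow> (\<forall>j<p. norm (signed_series a x (circle_pt R0 T (l + j))) < \<delta> * \<sigma>0)"

text \<open>With \<open>M = 2 * Q * \<sigma>0\<close> and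
  \<open>\<epsilon> = \<delta> * \<sigma>0\<close>, the lower bound ln M - 3 ln (M / \<epsilon>)
  equals ln \<sigma>0 - 2 ln (2 Q) - 3 (4 p + 5) ln m. The summand 2 pays for replacing
  \<open>\<sigma>0\<close> by \<open>sigma a R\<close>.\<close>

lemma jensen_sum_close:
  assumes x: "sign_seq x" and good: "\<And>l. l < T \<Longrightarrow> \<not> flat l x"
  shows "\<bar>jensen_sum (signed_series a x) R - ln (sigma a R)\<bar> \<le> 2 + 2 * ln (2 * Q) + 3 * (4 * real p + 5) * ln (real m)"
proof -
  let ?f = "signed_series a x"
  \<comment> \<open>The factor 2 makes the bound for \<open>?f\<close> strict.\<close>
  define M where "M = 2 * Q * \<sigma>0"
  have Q: "Q \<ge> 1" unfolding Q_def using m2 mult_mono[of 1 "exp 2" 1 "sqrt (real m)"] by simp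
  have M: "M > 0" using Q \<sigma>0_pos by (simp add: M_def)
  have bd: "norm (?f z) < M" if "norm z \<le> R" for z
  proof -
    have "norm (?f z) \<le> Q * \<sigma>0" using norm_signed_series_le[OF x that] majorant_le by linarith
    also have "\<dots> < M" using Q \<sigma>0_pos by (simp add: M_def)
    finally show ?thesis .
  qed
  have \<delta>: "\<delta> > 0" using m2 by (simp add: \<delta>_def)
  have lnM: "ln M = ln (2 * Q) + ln \<sigma>0" unfolding M_def using Q \<sigma>0_pos by (simp add: ln_mult)
  have "jensen_sum ?f R \<le> ln M"
    by (rule jensen_sum_le[OF signed_series_holomorphic[OF x] norm_signed_series_0[OF x] R])
      (use bd less_imp_le in auto)
  also have "\<dots> \<le> ln (sigma a R) + ln (2 * Q)"
    using sigma_R_bounds(1) \<sigma>0_pos lnM by (simp add: ln_mono)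
  finally have up: "jensen_sum ?f R \<le> ln (sigma a R) + ln (2 * Q)" .
  have "ln M - 3 * ln (M / (\<delta> * \<sigma>0)) \<le> jensen_sum ?f R"
  proof (rule jensen_sum_ge_of_net[OF signed_series_holomorphic[OF x] norm_signed_series_0[OF x] R0_pos _ _ bd])
    show "R0 < R" using R m2 by (simp add: R0_def)
    show "0 < \<delta> * \<sigma>0" using \<delta> \<sigma>0_pos by simp
    fix z :: complex assume z: "norm z = R0"
    obtain l where l: "l < T" "dist (circle_pt R0 T l) z \<le> R0 * (2 * pi / real T)"
      using circle_net[OF z T_pos] unfolding circle_pt_def by blast
    obtain j where j: "j < p" "\<delta> * \<sigma>0 \<le> norm (?f (circle_pt R0 T (l + j)))"
      using good[OF l(1)] unfolding flat_def by force
    have "dist (circle_pt R0 T (l + j)) z \<le> dist (circle_pt R0 T (l + j)) (circle_pt R0 T l) + dist (circle_pt R0 T l) z"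
      by (rule dist_triangle)
    also have "\<dots> \<le> R0 * (2 * pi * real j / real T) + R0 * (2 * pi / real T)"
      using dist_circle_pt_add[of R0 T l j] R0_pos l(2) by linarith
    also have "\<dots> = R0 * (2 * pi * (1 + real j) / real T)" by (simp add: add_divide_distrib algebra_simps)
    also have "\<dots> \<le> R0 * (2 * pi * (1 + real p) / real T)"
      using R0_pos j by (intro mult_left_mono divide_right_mono) auto
    also have "\<dots> \<le> R0 * (1 / (2 * real m))"
      using params R0_pos by (intro mult_left_mono) (auto simp: net_params_def T_def)
    also have "\<dots> \<le> (R - R0) / 2"
    proof -
      have "R = R0 * exp (1 / real m)" by (simp add: R0_def mult.assoc flip: exp_add)
      moreover have "R0 * (1 + 1 / real m) \<le> R0 * exp (1 / real m)"
        using R0_pos exp_ge_add_one_self[of "1 / real m"] by (intro mult_left_mono) auto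
      ultimately have "R0 + R0 * (1 / real m) \<le> R" by (simp add: algebra_simps)
      then show ?thesis by simp
    qed
    finally show "\<exists>c. norm c = R0 \<and> dist c z \<le> (R - R0) / 2 \<and> \<delta> * \<sigma>0 \<le> norm (?f c)"
      using j(2) norm_circle_pt[of R0 T "l + j"] R0_pos by (metis less_imp_le)
  qed
  moreover have "ln (M / (\<delta> * \<sigma>0)) = ln (2 * Q) + (4 * real p + 5) * ln (real m)"
  proof -
    have "M / (\<delta> * \<sigma>0) = 2 * Q * real m ^ (4 * p + 5)" using \<sigma>0_pos by (simp add: M_def \<delta>_def)
    then show ?thesis using Q m2 by (simp add: ln_mult ln_realpow)
  qed
  ultimately have "ln (2 * Q) + ln \<sigma>0 - 3 * (ln (2 * Q) + (4 * real p + 5) * ln (real m)) \<le> jensen_sum ?f R"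
    using lnM by simp
  then have lo: "ln (sigma a R) - 2 - 2 * ln (2 * Q) - 3 * (4 * real p + 5) * ln (real m) \<le> jensen_sum ?f R"
    using sigma_R_bounds(2) by (simp add: algebra_simps)
  have "ln (2 * Q) \<ge> 0" "3 * (4 * real p + 5) * ln (real m) \<ge> 0" using Q m2 by auto
  then show ?thesis using up lo by linarith
qed

definition "big = {n. n < T \<and> \<eta> * \<sigma>0 \<le> norm (a n) * R0 ^ n}"

lemma finite_big: "finite big" "big \<subseteq> {..<T}"
  by (auto simp: big_def)

text \<open>If the big terms are few, small samples of the series are small samples of the
  polynomial of big terms. Inverting them makes every big coefficient too small for
  \<open>large_coefficient\<close>.\<close>

lemma few_big_not_flat:
  assumes few: "card big \<le> p" and x: "sign_seq x"
  shows "\<not> flat l x"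
proof
  assume fl: "flat l x"
  define \<epsilon> where "\<epsilon> = (\<delta> + (real m)\<^sup>2 * \<eta> + Q * exp (- real m)) * \<sigma>0"
  obtain k where k: "k < T" "\<sigma>0 / (2 * real m) \<le> norm (a k) * R0 ^ k" using large_coefficient by blast
  \<comment> \<open>The threshold of \<open>big\<close> lies below the size of the large
    coefficient, so \<open>k\<close> is among the recoverable indices.\<close>
  have "\<eta> \<le> 1 / (2 * real m)"
  proof -
    have "2 * real m \<le> real m * real m" using m2 by (intro mult_right_mono) auto
    also have "\<dots> = real m ^ 2" by (simp add: power2_eq_square)
    also have "\<dots> \<le> real m ^ (2 * p + 4)" using m2 by (intro power_increasing) auto
    finally show ?thesis using m2 unfolding \<eta>_def by (intro divide_left_mono) auto
  qed
  then have "\<eta> * \<sigma>0 \<le> 1 / (2 * real m) * \<sigma>0" using \<sigma>0_pos by (intro mult_right_mono) auto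
  then have kb: "k \<in> big" using k by (simp add: big_def)
  have "norm (a k * of_real (x k)) * R0 ^ k \<le> real T ^ p * \<epsilon>"
  proof (rule coefficient_le_circle_values[OF finite_big kb few])
    show "0 \<le> R0" using R0_pos by simp
    fix j assume j: "j < p"
    define z where "z = circle_pt R0 T (l + j)"
    have nz: "norm z = R0" using R0_pos by (simp add: z_def norm_circle_pt)
    have 1: "norm (signed_series a x z) \<le> \<delta> * \<sigma>0" using fl j by (auto simp: flat_def z_def intro: less_imp_le)
    have 2: "norm (signed_series a x z - (\<Sum>n<T. a n * of_real (x n) * z ^ n)) \<le> Q * exp (- real m) * \<sigma>0"
      using signed_series_split[OF x, of z T] tail_le nz by simp
    have 3: "norm (\<Sum>n\<in>{..<T} - big. a n * of_real (x n) * z ^ n) \<le> (real m)\<^sup>2 * \<eta> * \<sigma>0"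
    proof -
      have "norm (\<Sum>n\<in>{..<T} - big. a n * of_real (x n) * z ^ n) \<le> (\<Sum>n\<in>{..<T} - big. \<eta> * \<sigma>0)"
        using x by (intro sum_norm_le) (auto simp: big_def norm_mult norm_power nz sign_seq_def)
      also have "\<dots> \<le> (\<Sum>n<T. \<eta> * \<sigma>0)" using m2 \<sigma>0_pos by (intro sum_mono2) (auto simp: \<eta>_def)
      finally show ?thesis by (simp add: T_def)
    qed
    have "(\<Sum>n<T. a n * of_real (x n) * z ^ n) = (\<Sum>n\<in>{..<T} - big. a n * of_real (x n) * z ^ n) + (\<Sum>n\<in>big. a n * of_real (x n) * z ^ n)"
      by (rule sum.subset_diff) (use finite_big in auto)
    then have "(\<Sum>n\<in>big. a n * of_real (x n) * z ^ n) = signed_series a x z - (signed_series a x z - (\<Sum>n<T. a n * of_real (x n) * z ^ n)) - (\<Sum>n\<in>{..<T} - big. a n * of_real (x n) * z ^ n)"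
      by simp
    also have "norm \<dots> \<le> \<delta> * \<sigma>0 + Q * exp (- real m) * \<sigma>0 + (real m)\<^sup>2 * \<eta> * \<sigma>0"
      by (intro order_trans[OF norm_triangle_ineq4] add_mono 1 2 3)
    finally show "norm (\<Sum>n\<in>big. a n * of_real (x n) * circle_pt R0 T (l + j) ^ n) \<le> \<epsilon>"
      by (simp add: \<epsilon>_def z_def algebra_simps)
  qed
  then have "norm (a k) * R0 ^ k \<le> real T ^ p * \<epsilon>" using x by (simp add: norm_mult sign_seq_def)
  also have "real T ^ p * \<epsilon> = (((real m)\<^sup>2) ^ p * (\<delta> + (real m)\<^sup>2 * \<eta> + Q * exp (- real m))) * \<sigma>0"
    by (simp add: \<epsilon>_def T_def)
  also have "\<dots> < 1 / (2 * real m) * \<sigma>0"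
    using params \<sigma>0_pos unfolding net_params_def \<delta>_def \<eta>_def Q_def by (intro mult_strict_right_mono) auto
  finally show False using k by simp
qed

text \<open>The difference of the two series is a polynomial supported on \<open>D\<close> with
  coefficients of modulus \<open>2 * norm (a n)\<close>. Small samples would push one of them below
  the threshold that defines \<open>big\<close>.\<close>

lemma flat_unique:
  assumes D: "D \<subseteq> big" "card D \<le> p" "D \<noteq> {}" and x: "sign_seq x" and y: "sign_seq y"
    and neg: "\<And>n. n \<in> D \<Longrightarrow> y n = - x n" and same: "\<And>n. n \<notin> D \<Longrightarrow> y n = x n"
    and fl: "flat l x" "flat l y"
  shows False
proof -
  obtain k where k: "k \<in> D" using D by blast
  have fD: "finite D" using D finite_big finite_subset by blast
  have "norm (2 * a k * of_real (x k)) * R0 ^ k \<le> real T ^ p * (2 * (\<delta> * \<sigma>0))"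
  proof (rule coefficient_le_circle_values[OF fD _ k D(2)])
    show "D \<subseteq> {..<T}" using D finite_big by blast
    show "0 \<le> R0" using R0_pos by simp
    fix j assume j: "j < p"
    define z where "z = circle_pt R0 T (l + j)"
    have s1: "(\<lambda>n. a n * of_real (x n) * z ^ n - a n * of_real (y n) * z ^ n) sums (signed_series a x z - signed_series a y z)"
      by (intro sums_diff signed_series_sums x y)
    have e: "(\<lambda>n. a n * of_real (x n) * z ^ n - a n * of_real (y n) * z ^ n)
       = (\<lambda>n. if n \<in> D then 2 * a n * of_real (x n) * z ^ n else 0)"
      using neg same by (auto simp: fun_eq_iff)
    have s2: "(\<lambda>n. if n \<in> D then 2 * a n * of_real (x n) * z ^ n else 0) sums (\<Sum>n\<in>D. 2 * a n * of_real (x n) * z ^ n)"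
      by (rule sums_If_finite_set[OF fD])
    have "(\<Sum>n\<in>D. 2 * a n * of_real (x n) * z ^ n) = signed_series a x z - signed_series a y z"
      by (rule sums_unique2[OF s2 s1[unfolded e]])
    also have "norm \<dots> \<le> \<delta> * \<sigma>0 + \<delta> * \<sigma>0"
      using fl j by (intro order_trans[OF norm_triangle_ineq4] add_mono) (auto simp: flat_def z_def intro: less_imp_le)
    finally show "norm (\<Sum>n\<in>D. 2 * a n * of_real (x n) * circle_pt R0 T (l + j) ^ n) \<le> 2 * (\<delta> * \<sigma>0)"
      by (simp add: z_def)
  qed
  then have "norm (a k) * R0 ^ k \<le> real T ^ p * \<delta> * \<sigma>0" using x by (simp add: norm_mult sign_seq_def)
  moreover have "\<eta> * \<sigma>0 \<le> norm (a k) * R0 ^ k" using k D by (auto simp: big_def)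
  ultimately have "\<eta> * \<sigma>0 \<le> real T ^ p * \<delta> * \<sigma>0" by linarith
  then have "\<eta> \<le> real T ^ p * \<delta>" using \<sigma>0_pos by simp
  also have "real T ^ p * \<delta> = \<eta> / real m"
  proof -
    have "real m ^ (4 * p + 5) = real m ^ (2 * p) * (real m ^ (2 * p + 4) * real m)"
      by (simp flip: power_add power_Suc2)
    then show ?thesis using m2 by (simp add: \<delta>_def \<eta>_def T_def power_mult)
  qed
  finally have "\<eta> \<le> \<eta> / real m" .
  moreover have "\<eta> > 0" using m2 by (simp add: \<eta>_def)
  ultimately show False using m2 by (simp add: field_simps)
qed

end

section \<open>Probability of small values\<close>

definition flip :: "nat set \<Rightarrow> (nat \<Rightarrow> bool) \<Rightarrow> nat \<Rightarrow> bool" where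
  "flip D b = (\<lambda>n. if n \<in> D then \<not> b n else b n)"

lemma space_coin_space [simp]: "space coin_space = UNIV"
  by (simp add: coin_space_def space_PiM)

lemma prob_space_coin_space: "prob_space coin_space"
  using rademacher_sequence_coin by (simp add: rademacher_sequence_def)

lemma measurable_coin_component [measurable]:
  "(\<lambda>b. b n) \<in> coin_space \<rightarrow>\<^sub>M measure_pmf (bernoulli_pmf (1/2))"
  unfolding coin_space_def by (rule measurable_component_singleton) simp

lemma measurable_coin_sign [measurable]: "coin_sign n \<in> borel_measurable coin_space"
proof -
  have "(\<lambda>c. if c then 1 else - 1 :: real) \<in> borel_measurable (measure_pmf (bernoulli_pmf (1/2)))" by simp
  then have "(\<lambda>b. (\<lambda>c. if c then 1 else - 1 :: real) (b n)) \<in> borel_measurable coin_space"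
    by (rule measurable_compose_rev[OF _ measurable_coin_component])
  then show ?thesis by (simp add: coin_sign_def[abs_def])
qed

lemma measurable_flip [measurable]: "flip D \<in> coin_space \<rightarrow>\<^sub>M coin_space"
proof -
  have "(\<lambda>b n. if n \<in> D then \<not> b n else b n) \<in> coin_space \<rightarrow>\<^sub>M PiM UNIV (\<lambda>_. measure_pmf (bernoulli_pmf (1/2)))"
  proof (rule measurable_PiM_single')
    fix n :: nat
    have g: "(\<lambda>c. if n \<in> D then \<not> c else c) \<in> measure_pmf (bernoulli_pmf (1/2)) \<rightarrow>\<^sub>M measure_pmf (bernoulli_pmf (1/2))"
      by simp
    show "(\<lambda>b. if n \<in> D then \<not> b n else b n) \<in> coin_space \<rightarrow>\<^sub>M measure_pmf (bernoulli_pmf (1/2))"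
      by (rule measurable_compose[OF measurable_coin_component g])
  qed auto
  then show ?thesis by (simp add: flip_def[abs_def] coin_space_def)
qed

text \<open>Negation preserves the law of a fair coin, and acting on coordinates separately
  preserves independence.\<close>

lemma distr_flip: "distr coin_space coin_space (flip D) = coin_space"
proof -
  let ?B = "measure_pmf (bernoulli_pmf (1/2))"
  interpret C: prob_space coin_space by (rule prob_space_coin_space)
  interpret P: product_prob_space "\<lambda>_::nat. ?B" UNIV by unfold_locales
  have dist: "distr coin_space ?B (\<lambda>b. b n) = ?B" for n
    unfolding coin_space_def by (rule P.PiM_component) simp
  have ind: "C.indep_vars (\<lambda>_. ?B) (\<lambda>n b. b n) UNIV"
  proof (subst C.indep_vars_iff_distr_eq_PiM')
    show "distr coin_space (PiM UNIV (\<lambda>_. ?B)) (\<lambda>x. \<lambda>i\<in>UNIV. x i)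
      = PiM UNIV (\<lambda>i. distr coin_space ?B (\<lambda>x. x i))"
      unfolding dist by (simp add: coin_space_def restrict_def distr_id2)
  qed (use measurable_coin_component in auto)
  define g where "g = (\<lambda>n c. if n \<in> D then \<not> c else c)"
  have g: "g n \<in> ?B \<rightarrow>\<^sub>M ?B" for n by simp
  have meas: "(\<lambda>x. g n (x n)) \<in> coin_space \<rightarrow>\<^sub>M ?B" for n
    by (rule measurable_compose[OF measurable_coin_component g])
  have "C.indep_vars (\<lambda>_. ?B) (\<lambda>n b. g n (b n)) UNIV"
    by (rule C.indep_vars_compose2[OF ind]) auto
  then have "distr coin_space (PiM UNIV (\<lambda>_. ?B)) (\<lambda>x. \<lambda>n\<in>UNIV. g n (x n))
      = PiM UNIV (\<lambda>n. distr coin_space ?B (\<lambda>x. g n (x n)))"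
    using meas by (subst (asm) C.indep_vars_iff_distr_eq_PiM') auto
  moreover have "distr coin_space ?B (\<lambda>x. g n (x n)) = ?B" for n
  proof -
    have "distr coin_space ?B (\<lambda>x. g n (x n)) = distr (distr coin_space ?B (\<lambda>x. x n)) ?B (g n)"
      by (subst distr_distr[OF g measurable_coin_component]) (simp add: o_def)
    also have "\<dots> = distr ?B ?B (g n)" by (simp add: dist)
    also have "\<dots> = ?B"
    proof (rule measure_eqI_countable[where A = UNIV])
      fix c
      have "emeasure (distr ?B ?B (g n)) {c} = emeasure ?B {if n \<in> D then \<not> c else c}"
        by (subst emeasure_distr) (auto simp: g_def vimage_def intro!: arg_cong2[where f = emeasure])
      also have "\<dots> = emeasure ?B {c}" by (simp add: emeasure_pmf_single)
      finally show "emeasure (distr ?B ?B (g n)) {c} = emeasure ?B {c}" .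
    qed auto
    finally show ?thesis .
  qed
  ultimately show ?thesis by (simp add: coin_space_def flip_def[abs_def] g_def restrict_def)
qed

text \<open>The preimages of \<open>A\<close> under the \<open>2 ^ card K\<close> flips by subsets
  of \<open>K\<close> are pairwise disjoint and as likely as \<open>A\<close>, so together they have
  probability at most 1.\<close>

lemma measure_le_of_flip_disjoint:
  assumes A: "A \<in> sets coin_space" and K: "finite K"
    and disj: "\<And>D b. D \<subseteq> K \<Longrightarrow> D \<noteq> {} \<Longrightarrow> b \<in> A \<Longrightarrow> flip D b \<notin> A"
  shows "measure coin_space A \<le> 1 / 2 ^ card K"
proof -
  interpret C: prob_space coin_space by (rule prob_space_coin_space)
  have V: "flip D -` A \<in> sets coin_space" for D
    using measurable_sets[OF measurable_flip A, of D] by simp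
  have eq: "C.prob (flip D -` A) = C.prob A" for D
  proof -
    have "measure (distr coin_space coin_space (flip D)) A = C.prob (flip D -` A)"
      by (subst measure_distr[OF measurable_flip A]) simp
    then show ?thesis by (simp add: distr_flip)
  qed
  have "disjoint_family_on (\<lambda>D. flip D -` A) (Pow K)"
    unfolding disjoint_family_on_def
  proof (intro ballI impI)
    fix D D' assume D: "D \<in> Pow K" "D' \<in> Pow K" "D \<noteq> D'"
    \<comment> \<open>Two flips of the same outcome differ by the flip of the symmetric difference,
      so both cannot land in \<open>A\<close>.\<close>
    define X where "X = (D - D') \<union> (D' - D)"
    have X: "X \<subseteq> K" "X \<noteq> {}" using D by (auto simp: X_def)
    have "flip X (flip D b) = flip D' b" for b by (auto simp: X_def flip_def fun_eq_iff)
    then show "flip D -` A \<inter> flip D' -` A = {}" using disj[OF X] by (metis disjoint_iff vimageE)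
  qed
  then have "C.prob (\<Union>D\<in>Pow K. flip D -` A) = (\<Sum>D\<in>Pow K. C.prob (flip D -` A))"
    using K V by (intro C.finite_measure_finite_Union) auto
  also have "\<dots> = 2 ^ card K * C.prob A" using K by (simp add: eq card_Pow)
  finally have "2 ^ card K * C.prob A \<le> 1" by (metis C.prob_le_1)
  then show ?thesis by (simp add: field_simps)
qed

lemma sign_seq_coin: "sign_seq (\<lambda>n. coin_sign n b)"
  by (simp add: sign_seq_def coin_sign_def)

lemma measurable_signed_series [measurable]:
  "(\<lambda>b. signed_series a (\<lambda>n. coin_sign n b) z) \<in> borel_measurable coin_space"
  unfolding signed_series_def by measurable

section \<open>Failure probability of a test circle\<close>

context test_circle
begin

definition "bad_set = {b. \<exists>l<T. flat l (\<lambda>n. coin_sign n b)}"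

lemma flat_set_measurable: "{b. flat l (\<lambda>n. coin_sign n b)} \<in> sets coin_space"
proof -
  have "{b \<in> space coin_space. \<forall>j<p. norm (signed_series a (\<lambda>n. coin_sign n b) (circle_pt R0 T (l + j))) < \<delta> * \<sigma>0} \<in> sets coin_space"
    by measurable
  then show ?thesis by (simp add: flat_def)
qed

lemma measure_flat_set: "measure coin_space {b. flat l (\<lambda>n. coin_sign n b)} \<le> 1 / 2 ^ p"
proof (cases "card big \<le> p")
  case True
  then have "{b. flat l (\<lambda>n. coin_sign n b)} = {}" using few_big_not_flat sign_seq_coin by blast
  then show ?thesis by simp
next
  case False
  \<comment> \<open>With exactly \<open>p\<close> indices every nonempty subset satisfies the size
    bound of \<open>flat_unique\<close>, and there are \<open>2 ^ p\<close> sign patterns.\<close>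
  then obtain K where K: "K \<subseteq> big" "card K = p" "finite K"
    by (meson finite_big(1) finite_subset nat_le_linear obtain_subset_with_card_n)
  have "measure coin_space {b. flat l (\<lambda>n. coin_sign n b)} \<le> 1 / 2 ^ card K"
  proof (rule measure_le_of_flip_disjoint[OF flat_set_measurable K(3)])
    fix D b assume D: "D \<subseteq> K" "D \<noteq> {}" and b: "b \<in> {b. flat l (\<lambda>n. coin_sign n b)}"
    have "card D \<le> p" using card_mono[OF K(3) D(1)] K(2) by simp
    moreover have "coin_sign n (flip D b) = - coin_sign n b" if "n \<in> D" for n
      using that by (simp add: coin_sign_def flip_def)
    moreover have "coin_sign n (flip D b) = coin_sign n b" if "n \<notin> D" for n
      using that by (simp add: coin_sign_def flip_def)
    ultimately show "flip D b \<notin> {b. flat l (\<lambda>n. coin_sign n b)}"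
      using flat_unique[OF _ _ D(2) sign_seq_coin[of b] sign_seq_coin[of "flip D b"], where l = l] D(1) K(1) b by blast
  qed
  then show ?thesis by (simp add: K)
qed

lemma bad_set_measurable: "bad_set \<in> sets coin_space"
proof -
  have "bad_set = (\<Union>l\<in>{..<T}. {b. flat l (\<lambda>n. coin_sign n b)})" by (auto simp: bad_set_def)
  then show ?thesis using flat_set_measurable by auto
qed

lemma measure_bad_set: "measure coin_space bad_set \<le> (real m)\<^sup>2 / 2 ^ p"
proof -
  interpret C: prob_space coin_space by (rule prob_space_coin_space)
  have "bad_set = (\<Union>l\<in>{..<T}. {b. flat l (\<lambda>n. coin_sign n b)})" by (auto simp: bad_set_def)
  then have "C.prob bad_set \<le> (\<Sum>l<T. C.prob {b. flat l (\<lambda>n. coin_sign n b)})"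
    using flat_set_measurable by (auto intro!: C.finite_measure_subadditive_finite)
  also have "\<dots> \<le> (\<Sum>l<T. 1 / 2 ^ p)" by (intro sum_mono measure_flat_set)
  finally show ?thesis by (simp add: T_def)
qed

end

section \<open>Choice of parameters and logarithmic measure\<close>

text \<open>Since ln 2 \<ge> 1/2, the factor 6 gives \<open>2 ^ p \<ge> m ^ 3\<close>; the union
  bound over \<open>m\<^sup>2\<close> arcs then leaves 1 / m.\<close>

definition net_size :: "nat \<Rightarrow> nat" where "net_size m = nat \<lceil>6 * ln (real m)\<rceil>"

lemma net_size_bounds:
  assumes "m \<ge> 1"
  shows "6 * ln (real m) \<le> real (net_size m)" "real (net_size m) \<le> 6 * ln (real m) + 1"
  using assms unfolding net_size_def by (auto simp: of_nat_nat intro: ceiling_correct)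

lemma ln_2_ge_half: "1 / 2 \<le> ln (2::real)"
  using ln_le_minus_one[of "1 / 2"] by (simp add: ln_div)

text \<open>With \<open>p = O(ln m)\<close> the inversion loss is the exponential of
  \<open>O((ln m)\<^sup>2)\<close>, which \<open>exp (- real m)\<close> overcomes. In the other two
  error terms the powers of \<open>m\<close> leave at most 1 / m^5 and 1 / m^2.\<close>

lemma eventually_net_params: "eventually (\<lambda>m. net_params m (net_size m)) sequentially"
proof -
  have e1: "eventually (\<lambda>m::nat. 2 * 4 * (6 * ln (real m) + 2) / (real m)\<^sup>2 \<le> 1 / (2 * real m)) sequentially"
    by real_asymp
  have e2: "eventually (\<lambda>m::nat. 1 / real m ^ 5 + 1 / real m ^ 2 + exp (2 * (6 * ln (real m) + 1) * ln (real m)) * (exp 2 * sqrt (real m) * exp (- real m)) < 1 / (2 * real m)) sequentially"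
    by real_asymp
  show ?thesis using e1 e2 eventually_ge_at_top[of 2]
  proof eventually_elim
    case (elim m)
    define p where "p = net_size m"
    have p: "real p \<le> 6 * ln (real m) + 1" using net_size_bounds[of m] elim by (simp add: p_def)
    have "2 * pi * (1 + real p) / (real m)\<^sup>2 \<le> 2 * 4 * (6 * ln (real m) + 2) / (real m)\<^sup>2"
      using p pi_less_4 by (intro divide_right_mono mult_mono) auto
    then have 1: "2 * pi * (1 + real p) / (real m)\<^sup>2 \<le> 1 / (2 * real m)" using elim by linarith
    have mp: "((real m)\<^sup>2) ^ p = exp (2 * real p * ln (real m))"
    proof -
      have "((real m)\<^sup>2) ^ p = (exp (ln (real m))) ^ (2 * p)" using elim by (simp add: power_mult)
      also have "\<dots> = exp (2 * real p * ln (real m))" by (simp flip: exp_of_nat_mult)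
      finally show ?thesis .
    qed
    have "((real m)\<^sup>2) ^ p * (1 / real m ^ (4 * p + 5) + (real m)\<^sup>2 * (1 / real m ^ (2 * p + 4)) + exp 2 * sqrt (real m) * exp (- real m))
       = 1 / real m ^ (2 * p + 5) + 1 / real m ^ 2 + exp (2 * real p * ln (real m)) * (exp 2 * sqrt (real m) * exp (- real m))"
    proof -
      have "((real m)\<^sup>2) ^ p * (1 / real m ^ (4 * p + 5)) = 1 / real m ^ (2 * p + 5)"
      proof -
        have "real m ^ (4 * p + 5) = real m ^ (2 * p) * real m ^ (2 * p + 5)" by (simp flip: power_add)
        then show ?thesis using elim by (simp add: power_mult)
      qed
      moreover have "((real m)\<^sup>2) ^ p * ((real m)\<^sup>2 * (1 / real m ^ (2 * p + 4))) = 1 / real m ^ 2"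
      proof -
        have "real m ^ (2 * p + 4) = real m ^ (2 * p) * (real m ^ 2 * real m ^ 2)" by (simp flip: power_add)
        then show ?thesis using elim by (simp add: power_mult power4_eq_xxxx power2_eq_square)
      qed
      ultimately show ?thesis unfolding distrib_left mp by simp
    qed
    also have "\<dots> \<le> 1 / real m ^ 5 + 1 / real m ^ 2 + exp (2 * (6 * ln (real m) + 1) * ln (real m)) * (exp 2 * sqrt (real m) * exp (- real m))"
    proof (intro add_mono mult_right_mono order_refl)
      have "real m ^ 5 \<le> real m ^ (2 * p + 5)" using elim by (intro power_increasing) auto
      then show "1 / real m ^ (2 * p + 5) \<le> 1 / real m ^ 5" using elim by (intro divide_left_mono) auto
      have "2 * real p * ln (real m) \<le> 2 * (6 * ln (real m) + 1) * ln (real m)"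
        using p elim by (intro mult_right_mono) auto
      then show "exp (2 * real p * ln (real m)) \<le> exp (2 * (6 * ln (real m) + 1) * ln (real m))" by simp
    qed auto
    also have "\<dots> < 1 / (2 * real m)" using elim by blast
    finally show ?case using 1 elim unfolding net_params_def p_def by blast
  qed
qed

lemma power_net_size:
  assumes "m \<ge> 1"
  shows "real m ^ 3 \<le> 2 ^ net_size m"
proof -
  have l: "ln (real m) \<ge> 0" using assms by simp
  have "real m ^ 3 = exp (ln (real m)) ^ 3" using assms by simp
  also have "\<dots> = exp (3 * ln (real m))" by (simp flip: exp_of_nat_mult)
  also have "\<dots> \<le> exp (real (net_size m) * ln 2)"
  proof -
    have "3 * ln (real m) = 6 * ln (real m) * (1 / 2)" by simp
    also have "\<dots> \<le> real (net_size m) * ln 2"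
      using net_size_bounds[OF assms] ln_2_ge_half l by (intro mult_mono) auto
    finally show ?thesis by simp
  qed
  also have "\<dots> = 2 ^ net_size m" by (simp add: exp_of_nat_mult)
  finally show ?thesis .
qed

text \<open>The quadratic term has coefficient 3 * 4 * 6 = 72, and 80 absorbs the lower order
  terms.\<close>

lemma eventually_jensen_error:
  "eventually (\<lambda>m. 2 + 2 * ln (2 * (exp 2 * sqrt (real m))) + 3 * (4 * real (net_size m) + 5) * ln (real m) \<le> 80 * (ln (real m))\<^sup>2) sequentially"
proof -
  have "eventually (\<lambda>m::nat. 2 + 2 * ln (2 * (exp 2 * sqrt (real m))) + 3 * (4 * (6 * ln (real m) + 1) + 5) * ln (real m) \<le> 80 * (ln (real m))\<^sup>2) sequentially"
    by real_asymp
  then show ?thesis using eventually_ge_at_top[of 1]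
  proof eventually_elim
    case (elim m)
    have "3 * (4 * real (net_size m) + 5) * ln (real m) \<le> 3 * (4 * (6 * ln (real m) + 1) + 5) * ln (real m)"
      using net_size_bounds[OF elim(2)] elim(2) by (intro mult_right_mono mult_left_mono add_right_mono) auto
    then show ?case using elim by linarith
  qed
qed

text \<open>The squared logarithm makes the lengths summable, and dividing by \<open>gap j\<close>
  costs only \<open>j * (ln j)\<^sup>2\<close>. At \<open>j = 0\<close> and \<open>j = 1\<close>
  division by zero gives the value 0.\<close>

definition gap :: "nat \<Rightarrow> real" where "gap j = 1 / (real j * (ln (real j))\<^sup>2)"

lemma summable_gap: "summable gap"
proof -
  have "(\<lambda>n. 1 / ln (real (n + 2))) \<longlonglongrightarrow> 0" by real_asymp
  from telescope_summable'[OF this]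
  have "summable (\<lambda>n. 1 / ln (real (n + 2)) - 1 / ln (real (Suc n + 2)))" by simp
  then have "summable (\<lambda>n. 4 * (1 / ln (real (n + 2)) - 1 / ln (real (Suc n + 2))))" by (rule summable_mult)
  \<comment> \<open>Comparison with the telescoping differences of 1 / ln; the shift by 2 avoids the
    indices where the logarithm is not positive.\<close>
  moreover have "eventually (\<lambda>n. norm (gap (n + 2)) \<le> 4 * (1 / ln (real (n + 2)) - 1 / ln (real (Suc n + 2)))) sequentially"
    unfolding gap_def real_norm_def by real_asymp
  ultimately have "summable (\<lambda>n. gap (n + 2))" by (rule summable_comparison_test_ev[rotated])
  then show ?thesis by (simp only: summable_iff_shift)
qed

section \<open>Sets of finite logarithmic measure\<close>

lemma log_measure_interval:
  assumes "0 < x" "0 \<le> h"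
  shows "(\<integral>\<^sup>+t\<in>{x..x * exp h}. ennreal (1 / t) \<partial>lebesgue) = ennreal h"
proof -
  have "(\<integral>\<^sup>+t. ennreal (1 / t) * indicator {x..x * exp h} t \<partial>lborel) = ennreal (ln (x * exp h) - ln x)"
  proof (rule nn_integral_FTC_Icc)
    show "x \<le> x * exp h" using assms by simp
    show "((\<lambda>t. ln t) has_real_derivative 1 / t) (at t)" if "t \<in> {x..x * exp h}" for t
      using assms that by (auto intro!: derivative_eq_intros)
    show "0 \<le> 1 / t" if "t \<in> {x..x * exp h}" for t using assms that by simp
  qed auto
  then show ?thesis using assms by (simp add: nn_integral_completion ln_mult)
qed

lemma finite_log_measure_intervals:
  assumes x: "\<And>j. x j > 0" and h: "\<And>j. h j \<ge> 0" and s: "summable h"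
  shows "finite_log_measure ({1..} \<inter> (\<Union>j::nat. {x j..x j * exp (h j)}))"
  unfolding finite_log_measure_def
proof (intro conjI)
  let ?E = "{1..} \<inter> (\<Union>j::nat. {x j..x j * exp (h j)})"
  show "?E \<in> sets lebesgue" by (intro sets.Int sets.countable_UN) auto
  have "(\<integral>\<^sup>+t\<in>?E. ennreal (1 / t) \<partial>lebesgue)
      \<le> (\<integral>\<^sup>+t. (\<Sum>j. ennreal (1 / t) * indicator {x j..x j * exp (h j)} t) \<partial>lebesgue)"
  proof (rule nn_integral_mono)
    fix t :: real
    show "ennreal (1 / t) * indicator ?E t \<le> (\<Sum>j. ennreal (1 / t) * indicator {x j..x j * exp (h j)} t)"
    proof (cases "t \<in> ?E")
      case True
      then obtain j where "t \<in> {x j..x j * exp (h j)}" by blast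
      then have "ennreal (1 / t) = (\<Sum>i\<in>{j}. ennreal (1 / t) * indicator {x i..x i * exp (h i)} t)" by simp
      also have "\<dots> \<le> (\<Sum>j. ennreal (1 / t) * indicator {x j..x j * exp (h j)} t)"
        by (rule sum_le_suminf) auto
      finally show ?thesis using True by simp
    qed simp
  qed
  also have "\<dots> = (\<Sum>j. \<integral>\<^sup>+t. ennreal (1 / t) * indicator {x j..x j * exp (h j)} t \<partial>lebesgue)"
    by (rule nn_integral_suminf) (auto intro!: measurable_completion)
  also have "\<dots> = (\<Sum>j. ennreal (h j))" using log_measure_interval[OF x h] by simp
  also have "\<dots> = ennreal (\<Sum>j. h j)" by (rule suminf_ennreal2[OF h s])
  also have "\<dots> < \<infinity>" by simp
  finally show "(\<integral>\<^sup>+t\<in>?E. ennreal (1 / t) \<partial>lebesgue) < \<infinity>" .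
qed auto

lemma finite_log_measure_Un:
  assumes "finite_log_measure A" "finite_log_measure B"
  shows "finite_log_measure (A \<union> B)"
proof -
  have "(\<integral>\<^sup>+t\<in>A \<union> B. ennreal (1 / t) \<partial>lebesgue)
     \<le> (\<integral>\<^sup>+t. ennreal (1 / t) * indicator A t + ennreal (1 / t) * indicator B t \<partial>lebesgue)"
    by (intro nn_integral_mono) (auto simp: indicator_def)
  also have "\<dots> = (\<integral>\<^sup>+t\<in>A. ennreal (1 / t) \<partial>lebesgue) + (\<integral>\<^sup>+t\<in>B. ennreal (1 / t) \<partial>lebesgue)"
  proof (intro nn_integral_add borel_measurable_times_ennreal borel_measurable_indicator)
    show "(\<lambda>t. ennreal (1 / t)) \<in> borel_measurable lebesgue" by (intro measurable_completion) simp
    then show "(\<lambda>t. ennreal (1 / t)) \<in> borel_measurable lebesgue" .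
  qed (use assms in \<open>auto simp: finite_log_measure_def\<close>)
  finally show ?thesis using assms by (auto simp: finite_log_measure_def intro: le_less_trans)
qed

lemma zero_count_mono:
  assumes "f holomorphic_on UNIV" "f 0 \<noteq> 0" "R \<le> R'"
  shows "zero_count f R \<le> zero_count f R'"
  unfolding zero_count_def
  by (rule sum_mono2) (use assms zero_set_finite[OF assms(1,2)] in auto)

section \<open>Transcendental series\<close>

context unit_entire
begin

definition "good_radius m R \<longleftrightarrow> R > 0 \<and> net_params m (net_size m) \<and> log_deriv_sigma a (R * exp (1 / real m)) \<le> real m"

text \<open>The empty set outside good radii lets measurability and the probability bound hold for
  every \<open>R\<close>, so the test radii can be chosen before they are known to be good.\<close>

definition "bad m R = (if good_radius m R then test_circle.bad_set a m (net_size m) R else {})"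

lemma bad_measurable: "bad m R \<in> sets coin_space"
proof (cases "good_radius m R")
  case True
  then interpret test_circle a m "net_size m" R by unfold_locales (auto simp: good_radius_def)
  show ?thesis using bad_set_measurable True by (simp add: bad_def)
qed (simp add: bad_def)

lemma measure_bad:
  assumes "m \<ge> 1"
  shows "measure coin_space (bad m R) \<le> 1 / real m"
proof (cases "good_radius m R")
  case True
  then interpret test_circle a m "net_size m" R by unfold_locales (auto simp: good_radius_def)
  have "measure coin_space (bad m R) \<le> (real m)\<^sup>2 / 2 ^ net_size m"
    using measure_bad_set True by (simp add: bad_def)
  also have "\<dots> \<le> (real m)\<^sup>2 / real m ^ 3"
    using power_net_size[OF assms] assms by (intro divide_left_mono) auto
  also have "\<dots> = 1 / real m" using assms by (simp add: power3_eq_cube power2_eq_square)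
  finally show ?thesis .
qed (simp add: bad_def)

lemma jensen_sum_close_of_not_bad:
  assumes "good_radius m R" "b \<notin> bad m R"
    and "2 + 2 * ln (2 * (exp 2 * sqrt (real m))) + 3 * (4 * real (net_size m) + 5) * ln (real m) \<le> 80 * (ln (real m))\<^sup>2"
  shows "\<bar>jensen_sum (signed_series a (\<lambda>n. coin_sign n b)) R - ln (sigma a R)\<bar> \<le> 80 * (ln (real m))\<^sup>2"
proof -
  interpret test_circle a m "net_size m" R using assms(1) by unfold_locales (auto simp: good_radius_def)
  have "\<bar>jensen_sum (signed_series a (\<lambda>n. coin_sign n b)) R - ln (sigma a R)\<bar>
     \<le> 2 + 2 * ln (2 * Q) + 3 * (4 * real (net_size m) + 5) * ln (real m)"
    by (rule jensen_sum_close[OF sign_seq_coin]) (use assms(1,2) in \<open>auto simp: bad_def bad_set_def\<close>)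
  then show ?thesis using assms(3) by (simp add: Q_def)
qed

text \<open>The deterministic step. The increment over the first piece bounds the zero count from
  below, and that over [v1, v2] from above. Replacing \<open>s\<close> by \<open>j\<^sup>2\<close>
  costs O(j). The Jensen error divided by the gap costs O(j (ln j)^4), two logarithms coming from
  each.\<close>

lemma zero_count_close:
  assumes sg: "sign_seq x" and j: "j \<ge> 3"
    and s: "log_deriv_sigma a u = (real j)\<^sup>2" "log_deriv_sigma a v = (real (Suc j))\<^sup>2" and u: "u > 0"
    and r: "u * exp (gap j) \<le> r" "r \<le> v * exp (- (2 * gap j))"
    and close: "\<And>R. R \<in> {u, u * exp (gap j), v * exp (- (2 * gap j)), v * exp (- gap j)} \<Longrightarrow>
       \<bar>jensen_sum (signed_series a x) R - ln (sigma a R)\<bar> \<le> 80 * (ln ((real (Suc j))\<^sup>2))\<^sup>2"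
  shows "\<bar>real (zero_count (signed_series a x) r) - log_deriv_sigma a r\<bar>
     \<le> 3000 * sqrt (log_deriv_sigma a r) * (ln (log_deriv_sigma a r)) ^ 4"
proof -
  let ?f = "signed_series a x"
  define h where "h = gap j"
  define A where "A = 80 * (ln ((real (Suc j))\<^sup>2))\<^sup>2"
  define l where "l = ln (real j)"
  have l: "l \<ge> 1"
  proof -
    have "exp 1 \<le> real j" using exp_le j by (simp add: order_trans[OF exp_le])
    then show ?thesis using j by (simp add: l_def ln_ge_iff)
  qed
  have h: "h > 0" using j l by (simp add: h_def gap_def l_def)
  have hol: "?f holomorphic_on UNIV" by (rule signed_series_holomorphic[OF sg])
  have f0: "?f 0 \<noteq> 0" using norm_signed_series_0[OF sg] by auto
  define u' where "u' = u * exp h"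
  define v1 where "v1 = v * exp (- (2 * h))"
  define v2 where "v2 = v * exp (- h)"
  have u': "u \<le> u'" "u' > 0" "ln (u' / u) = h" using u h by (auto simp: u'_def)
  have r0: "r > 0" using u' r by (simp add: u'_def h_def)
  then have "v * exp (- (2 * h)) > 0" using r(2) unfolding h_def by linarith
  then have v: "v > 0" by (simp add: zero_less_mult_iff)
  have v2e: "v2 = v1 * exp h" by (simp add: v1_def v2_def mult.assoc flip: exp_add)
  have v1: "v1 > 0" "v1 \<le> v2" "ln (v2 / v1) = h" "v2 > 0" "v2 \<le> v"
    using v h by (auto simp: v2e) (auto simp: v1_def mult.assoc simp flip: exp_add)
  have ru: "u' \<le> r" "r \<le> v1" using r by (auto simp: u'_def v1_def h_def)
  have cl: "\<bar>jensen_sum ?f u - ln (sigma a u)\<bar> \<le> A" "\<bar>jensen_sum ?f u' - ln (sigma a u')\<bar> \<le> A"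
    "\<bar>jensen_sum ?f v1 - ln (sigma a v1)\<bar> \<le> A" "\<bar>jensen_sum ?f v2 - ln (sigma a v2)\<bar> \<le> A"
    using close by (auto simp: A_def u'_def v1_def v2_def h_def)
  have lo: "(real j)\<^sup>2 * h - 2 * A \<le> real (zero_count ?f r) * h"
  proof -
    have "(real j)\<^sup>2 * h \<le> ln (sigma a u') - ln (sigma a u)"
      using ln_sigma_increment_ge[of u u'] u u' s by simp
    also have "\<dots> \<le> jensen_sum ?f u' - jensen_sum ?f u + 2 * A" using cl by linarith
    also have "jensen_sum ?f u' - jensen_sum ?f u \<le> real (zero_count ?f u') * h"
      using jensen_sum_increment(2)[OF hol f0 u u'(1)] u' by simp
    also have "real (zero_count ?f u') * h \<le> real (zero_count ?f r) * h"
      using zero_count_mono[OF hol f0 ru(1)] h by (intro mult_right_mono) auto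
    finally show ?thesis by simp
  qed
  \<comment> \<open>The last piece stops at \<open>v2 < v\<close>: test circles must leave room for
    the enlargement by \<open>exp (1 / real m)\<close>.\<close>
  have up: "real (zero_count ?f r) * h \<le> (real (Suc j))\<^sup>2 * h + 2 * A"
  proof -
    have "real (zero_count ?f r) * h \<le> real (zero_count ?f v1) * h"
      using zero_count_mono[OF hol f0 ru(2)] h by (intro mult_right_mono) auto
    also have "\<dots> \<le> jensen_sum ?f v2 - jensen_sum ?f v1"
      using jensen_sum_increment(1)[OF hol f0 v1(1,2)] v1 by simp
    also have "\<dots> \<le> ln (sigma a v2) - ln (sigma a v1) + 2 * A" using cl by linarith
    also have "ln (sigma a v2) - ln (sigma a v1) \<le> log_deriv_sigma a v2 * h"
      using ln_sigma_increment_le[of v1 v2] v1 by simp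
    also have "\<dots> \<le> (real (Suc j))\<^sup>2 * h"
      using log_deriv_sigma_mono[of v2 v] v1 s h by (intro mult_right_mono) auto
    finally show ?thesis by simp
  qed
  define s where "s = log_deriv_sigma a r"
  have s1: "(real j)\<^sup>2 \<le> s" using log_deriv_sigma_mono[of u r] u u' ru s by (simp add: s_def)
  have s2: "s \<le> (real (Suc j))\<^sup>2" using log_deriv_sigma_mono[of r v] r0 ru v1 s by (simp add: s_def)
  \<comment> \<open>80 * 2^2 = 320 from the square inside the logarithm, another factor 4 from ln (j
    + 1) \<le> 2 l, and 2 for the two radii: 2560.\<close>
  have Ah: "2 * A / h \<le> 2560 * (real j * l ^ 4)"
  proof -
    have "ln (real (Suc j)) \<le> ln ((real j)\<^sup>2)"
    proof (rule ln_mono)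
      have "real (Suc j) \<le> real j * 3" using j by simp
      also have "\<dots> \<le> real j * real j" using j by (intro mult_left_mono) auto
      finally show "real (Suc j) \<le> (real j)\<^sup>2" by (simp add: power2_eq_square)
    qed (use j in auto)
    then have "ln (real (Suc j)) \<le> 2 * l" using j by (simp add: l_def ln_realpow)
    then have "(ln (real (Suc j)))\<^sup>2 \<le> (2 * l)\<^sup>2" by (intro power_mono) auto
    moreover have "A = 320 * (ln (real (Suc j)))\<^sup>2" by (simp add: A_def ln_realpow power_mult_distrib del: of_nat_Suc)
    ultimately have "A \<le> 1280 * l\<^sup>2" by (simp add: power_mult_distrib)
    moreover have "1 / h = real j * l\<^sup>2" by (simp add: h_def gap_def l_def)
    ultimately have "2 * A * (1 / h) \<le> 2 * (1280 * l\<^sup>2) * (real j * l\<^sup>2)"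
      by (simp only:) (intro mult_right_mono; simp)
    also have "\<dots> = 2560 * (real j * l ^ 4)" by (simp add: power4_eq_xxxx power2_eq_square)
    finally show ?thesis by simp
  qed
  have "real (zero_count ?f r) \<le> (real (Suc j))\<^sup>2 + 2 * A / h" using up h by (simp add: field_simps)
  moreover have "(real j)\<^sup>2 - 2 * A / h \<le> real (zero_count ?f r)" using lo h by (simp add: field_simps)
  moreover have "(real (Suc j))\<^sup>2 = (real j)\<^sup>2 + 2 * real j + 1" by (simp add: power2_eq_square algebra_simps)
  ultimately have "\<bar>real (zero_count ?f r) - s\<bar> \<le> 2 * real j + 1 + 2560 * (real j * l ^ 4)"
    using s1 s2 Ah by linarith
  also have "\<dots> \<le> 3 * (real j * l ^ 4) + 2560 * (real j * l ^ 4)"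
  proof -
    have "1 \<le> l ^ 4" using l by simp
    then have "3 * (real j * 1) \<le> 3 * (real j * l ^ 4)" by (intro mult_left_mono) auto
    moreover have "2 * real j + 1 \<le> 3 * (real j * 1)" using j by simp
    ultimately show ?thesis by linarith
  qed
  also have "\<dots> \<le> 3000 * (real j * l ^ 4)" by simp
  also have "\<dots> \<le> 3000 * (sqrt s * ln s ^ 4)"
  proof (intro mult_left_mono mult_mono power_mono)
    show "real j \<le> sqrt s" using s1 real_le_rsqrt by blast
    have "real j * 1 \<le> real j * real j" using j by (intro mult_left_mono) auto
    then have "real j \<le> s" using s1 by (simp add: power2_eq_square)
    then show "l \<le> ln s" using j by (simp add: l_def ln_mono)
  qed (use l s1 in \<open>auto intro: order_trans[OF zero_le_power2]\<close>)
  finally show ?thesis by (simp add: s_def mult.assoc)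
qed

lemma zero_count_close_AE:
  assumes inf: "\<And>N. \<exists>n\<ge>N. a n \<noteq> 0"
  shows "\<exists>E. finite_log_measure E \<and> (AE b in coin_space. \<exists>r0\<ge>1. \<forall>r\<ge>r0. r \<notin> E \<longrightarrow>
     \<bar>real (zero_count (signed_series a (\<lambda>n. coin_sign n b)) r) - log_deriv_sigma a r\<bar>
     \<le> 3000 * sqrt (log_deriv_sigma a r) * (ln (log_deriv_sigma a r)) ^ 4)"
proof -
  interpret C: prob_space coin_space by (rule prob_space_coin_space)
  let ?s = "log_deriv_sigma a"
  \<comment> \<open>The parameter \<open>m\<close> of the test circles on the \<open>j\<close>-th
    interval is the value of \<open>?s\<close> at its right end.\<close>
  define M where "M = (\<lambda>j::nat. (Suc j)\<^sup>2)"
  have M: "filterlim M at_top sequentially"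
    unfolding M_def by (intro filterlim_subseq strict_monoI power_strict_mono) auto
  have "eventually (\<lambda>j. net_params (M j) (net_size (M j))) sequentially"
    using eventually_compose_filterlim[OF eventually_net_params M] .
  moreover have "eventually (\<lambda>j. 2 + 2 * ln (2 * (exp 2 * sqrt (real (M j)))) + 3 * (4 * real (net_size (M j)) + 5) * ln (real (M j)) \<le> 80 * (ln (real (M j)))\<^sup>2) sequentially"
    using eventually_compose_filterlim[OF eventually_jensen_error M] .
  \<comment> \<open>This keeps an enlarged test circle of radius at most
    \<open>\<rho> (Suc j) * exp (- gap j)\<close> within radius
    \<open>\<rho> (Suc j)\<close>.\<close>
  moreover have "eventually (\<lambda>j. 1 / real (M j) \<le> gap j) sequentially"
    unfolding M_def gap_def of_nat_power of_nat_Suc by real_asymp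
  moreover have "eventually (\<lambda>j::nat. ?s 1 < (real j)\<^sup>2) sequentially"
  proof -
    have "filterlim (\<lambda>j::nat. (real j)\<^sup>2) at_top sequentially" by real_asymp
    then show ?thesis unfolding filterlim_at_top_dense by blast
  qed
  ultimately have "eventually (\<lambda>j. net_params (M j) (net_size (M j)) \<and>
     2 + 2 * ln (2 * (exp 2 * sqrt (real (M j)))) + 3 * (4 * real (net_size (M j)) + 5) * ln (real (M j)) \<le> 80 * (ln (real (M j)))\<^sup>2
     \<and> 1 / real (M j) \<le> gap j \<and> ?s 1 < (real j)\<^sup>2 \<and> j \<ge> 3) sequentially"
    using eventually_ge_at_top[of 3] by eventually_elim blast
  then obtain j0 where j0: "\<And>j. j \<ge> j0 \<Longrightarrow> net_params (M j) (net_size (M j))"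
    "\<And>j. j \<ge> j0 \<Longrightarrow> 2 + 2 * ln (2 * (exp 2 * sqrt (real (M j)))) + 3 * (4 * real (net_size (M j)) + 5) * ln (real (M j)) \<le> 80 * (ln (real (M j)))\<^sup>2"
    "\<And>j. j \<ge> j0 \<Longrightarrow> 1 / real (M j) \<le> gap j" "\<And>j. j \<ge> j0 \<Longrightarrow> ?s 1 < (real j)\<^sup>2" "\<And>j. j \<ge> j0 \<Longrightarrow> j \<ge> 3"
    unfolding eventually_sequentially by blast
  have "\<exists>r\<ge>1. j \<ge> j0 \<longrightarrow> ?s r = (real j)\<^sup>2" for j
  proof (cases "j \<ge> j0")
    case True
    obtain r1 where r1: "r1 \<ge> 1" "?s r1 > (real j)\<^sup>2" using log_deriv_sigma_unbounded[OF inf] by blast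
    have "\<exists>r\<ge>1. r \<le> r1 \<and> ?s r = (real j)\<^sup>2"
      by (rule IVT') (use r1 j0(4)[OF True] log_deriv_sigma_cont in auto)
    then show ?thesis by blast
  qed auto
  then obtain \<rho> where \<rho>: "\<And>j. \<rho> j \<ge> 1" "\<And>j. j \<ge> j0 \<Longrightarrow> ?s (\<rho> j) = (real j)\<^sup>2" by metis
  have gap0: "gap j \<ge> 0" for j by (simp add: gap_def)
  \<comment> \<open>Each interval loses a piece of logarithmic length \<open>gap j\<close> at its
    start and one of length \<open>2 * gap j\<close> at its end. Below \<open>j0\<close> the values
    of \<open>\<rho>\<close> are arbitrary, which keeps the total length finite.\<close>
  define E where "E = ({1..} \<inter> (\<Union>j. {\<rho> j..\<rho> j * exp (gap j)})) \<union>
     ({1..} \<inter> (\<Union>j. {\<rho> (Suc j) * exp (- (2 * gap j))..\<rho> (Suc j) * exp (- (2 * gap j)) * exp (2 * gap j)}))"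
  have \<rho>0: "\<rho> j > 0" for j using \<rho>(1)[of j] by linarith
  have E: "finite_log_measure E" unfolding E_def
    using \<rho>0 gap0 summable_gap by (intro finite_log_measure_Un finite_log_measure_intervals) (auto intro: summable_mult)
  define tests where "tests = (\<lambda>j. {\<rho> j, \<rho> j * exp (gap j), \<rho> (Suc j) * exp (- (2 * gap j)), \<rho> (Suc j) * exp (- gap j)})"
  define B where "B = (\<lambda>j. \<Union>R\<in>tests j. bad (M j) R)"
  have Bm: "B j \<in> sets coin_space" for j
    unfolding B_def tests_def using bad_measurable by auto
  have pB: "C.prob (B j) \<le> 4 * (1 / real (M j))" for j
  proof -
    have "C.prob (B j) \<le> (\<Sum>R\<in>tests j. C.prob (bad (M j) R))"
      unfolding B_def using bad_measurable by (intro C.finite_measure_subadditive_finite) (auto simp: tests_def)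
    also have "\<dots> \<le> (\<Sum>R\<in>tests j. 1 / real (M j))" by (intro sum_mono measure_bad) (simp add: M_def)
    also have "\<dots> = real (card (tests j)) * (1 / real (M j))" by simp
    also have "\<dots> \<le> 4 * (1 / real (M j))"
    proof (intro mult_right_mono)
      have "card (tests j) \<le> 4" 
        using card_length[of "[\<rho> j, \<rho> j * exp (gap j), \<rho> (Suc j) * exp (- (2 * gap j)), \<rho> (Suc j) * exp (- gap j)]"]
        by (simp add: tests_def)
      then show "real (card (tests j)) \<le> 4" by simp
    qed simp
    finally show ?thesis .
  qed
  have sM: "summable (\<lambda>j. 4 * (1 / real (M j)))"
  proof -
    have "summable (\<lambda>n. 1 / (real n)\<^sup>2)" using inverse_power_summable[of 2, where 'a = real] by (simp add: inverse_eq_divide)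
    then have "summable (\<lambda>j. 1 / (real (Suc j))\<^sup>2)" by (subst summable_Suc_iff)
    then show ?thesis by (intro summable_mult) (simp add: M_def)
  qed
  have sB: "summable (\<lambda>j. C.prob (B j))"
    by (rule summable_comparison_test'[OF sM, of 0]) (use pB in auto)
  have "AE b in coin_space. eventually (\<lambda>j. b \<in> space coin_space - B j) sequentially"
    by (rule borel_cantelli_AE1[OF Bm _ sB]) (simp add: C.emeasure_eq_measure)
  then have "AE b in coin_space. \<exists>r0\<ge>1. \<forall>r\<ge>r0. r \<notin> E \<longrightarrow>
     \<bar>real (zero_count (signed_series a (\<lambda>n. coin_sign n b)) r) - ?s r\<bar>
     \<le> 3000 * sqrt (?s r) * (ln (?s r)) ^ 4"
  proof eventually_elim
    case (elim b)
    then obtain j1 where j1: "\<And>j. j \<ge> j1 \<Longrightarrow> b \<notin> B j" unfolding eventually_sequentially by auto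
    define J where "J = max j0 j1"
    show ?case
    proof (intro exI[of _ "\<rho> J"] conjI allI impI)
      fix r assume r: "\<rho> J \<le> r" "r \<notin> E"
      have r1: "r \<ge> 1" using r \<rho>(1)[of J] by linarith
      \<comment> \<open>The interval containing \<open>r\<close> is found from the largest index
        with \<open>\<rho> j \<le> r\<close>; it exists because
        \<open>j \<le> j\<^sup>2 \<le> ?s r\<close>.\<close>
      define S where "S = {j. j \<ge> J \<and> \<rho> j \<le> r}"
      have "S \<subseteq> {..nat \<lceil>?s r\<rceil>}"
      proof
        fix j assume "j \<in> S"
        then have "(real j)\<^sup>2 \<le> ?s r"
          using \<rho>(2)[of j] log_deriv_sigma_mono[OF \<rho>0[of j], of r] by (simp add: S_def J_def)
        moreover have "real j \<le> (real j)\<^sup>2" using power_increasing[of 1 2 "real j"] by (cases "j = 0") auto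
        ultimately have "real j \<le> ?s r" by linarith
        then show "j \<in> {..nat \<lceil>?s r\<rceil>}" unfolding atMost_iff by linarith
      qed
      then have finS: "finite S" using finite_subset by blast
      define j where "j = Max S"
      have "J \<in> S" using r by (simp add: S_def)
      then have "j \<in> S" unfolding j_def using finS by (intro Max_in) auto
      then have j: "j \<ge> j0" "j \<ge> j1" "\<rho> j \<le> r" "j \<ge> J" by (auto simp: S_def J_def)
      have rlt: "r < \<rho> (Suc j)"
      proof (rule ccontr)
        assume "\<not> ?thesis"
        then have "Suc j \<in> S" using j by (simp add: S_def)
        then show False using Max_ge[OF finS] unfolding j_def by fastforce
      qed
      have e2: "\<rho> (Suc j) * exp (- (2 * gap j)) * exp (2 * gap j) = \<rho> (Suc j)"
        by (simp add: mult.assoc flip: exp_add)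
      have rE: "\<rho> j * exp (gap j) < r" "r < \<rho> (Suc j) * exp (- (2 * gap j))"
      proof -
        have "r \<notin> {\<rho> j..\<rho> j * exp (gap j)}" using r(2) r1 unfolding E_def by blast
        then show "\<rho> j * exp (gap j) < r" using j by simp
        have "r \<notin> {\<rho> (Suc j) * exp (- (2 * gap j))..\<rho> (Suc j)}"
          using r(2) r1 e2 unfolding E_def by (metis (no_types, lifting) IntI UN_I UNIV_I UnI2 atLeast_iff)
        then show "r < \<rho> (Suc j) * exp (- (2 * gap j))" using rlt by simp
      qed
      have Mr: "real (M j) = (real (Suc j))\<^sup>2" by (simp add: M_def)
      show "\<bar>real (zero_count (signed_series a (\<lambda>n. coin_sign n b)) r) - ?s r\<bar>
         \<le> 3000 * sqrt (?s r) * (ln (?s r)) ^ 4"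
      proof (rule zero_count_close[OF sign_seq_coin j0(5)[OF j(1)] \<rho>(2)[OF j(1)] \<rho>(2)[of "Suc j"] \<rho>0])
        fix R assume R: "R \<in> {\<rho> j, \<rho> j * exp (gap j), \<rho> (Suc j) * exp (- (2 * gap j)), \<rho> (Suc j) * exp (- gap j)}"
        have R': "0 < R" "R \<le> \<rho> (Suc j) * exp (- gap j)"
        proof -
          show "0 < R" using R \<rho>0 by auto
          have g: "1 \<le> exp (gap j)" using gap0 by simp
          have a1: "\<rho> j \<le> \<rho> j * exp (gap j)" using g \<rho>0[of j] by simp
          have a2: "\<rho> (Suc j) * exp (- (2 * gap j)) \<le> \<rho> (Suc j) * exp (- gap j)"
            using gap0[of j] \<rho>0[of "Suc j"] by (intro mult_left_mono) auto
          show "R \<le> \<rho> (Suc j) * exp (- gap j)" using R a1 a2 rE by auto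
        qed
        have "R * exp (1 / real (M j)) \<le> \<rho> (Suc j) * exp (- gap j) * exp (gap j)"
          using R' j0(3)[OF j(1)] by (intro mult_mono) auto
        also have "\<dots> = \<rho> (Suc j)" by (simp add: mult.assoc flip: exp_add)
        finally have "?s (R * exp (1 / real (M j))) \<le> ?s (\<rho> (Suc j))"
          using R' by (intro log_deriv_sigma_mono) auto
        also have "\<dots> = real (M j)" using \<rho>(2)[of "Suc j"] j Mr by simp
        finally have "good_radius (M j) R" using R' j0(1)[OF j(1)] by (simp add: good_radius_def)
        moreover have "b \<notin> bad (M j) R" using j1[OF j(2)] R by (auto simp: B_def tests_def)
        ultimately show "\<bar>jensen_sum (signed_series a (\<lambda>n. coin_sign n b)) R - ln (sigma a R)\<bar> \<le> 80 * (ln ((real (Suc j))\<^sup>2))\<^sup>2"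
          using jensen_sum_close_of_not_bad[OF _ _ j0(2)[OF j(1)]] Mr by metis
      qed (use rE j in auto)
    qed (rule \<rho>(1))
  qed
  with E show ?thesis by blast
qed

end

section \<open>Polynomials\<close>

context unit_entire
begin

lemma signed_polynomial_eq:
  assumes deg: "\<forall>n>d. a n = 0"
  shows "signed_series a x z = (\<Sum>n\<le>d. a n * of_real (x n) * z ^ n)"
  unfolding signed_series_def by (rule suminf_finite) (use deg in auto)

lemma log_deriv_sigma_le_degree:
  assumes deg: "\<forall>n>d. a n = 0"
  shows "log_deriv_sigma a r \<le> real d"
proof -
  have "isq (r\<^sup>2) \<le> (\<Sum>n. real d * ((norm (a n))\<^sup>2 * (r\<^sup>2) ^ n))"
    unfolding isq_def
  proof (intro suminf_le summable_index_square_coeff summable_mult summable_square_coeff)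
    fix n
    have "real n * ((norm (a n))\<^sup>2 * (r\<^sup>2) ^ n) \<le> real d * ((norm (a n))\<^sup>2 * (r\<^sup>2) ^ n)"
      by (cases "n \<le> d") (auto intro: mult_right_mono simp: deg)
    then show "real n * (norm (a n))\<^sup>2 * (r\<^sup>2) ^ n \<le> real d * ((norm (a n))\<^sup>2 * (r\<^sup>2) ^ n)" by (simp add: mult.assoc)
  qed
  also have "\<dots> = real d * sq (r\<^sup>2)" unfolding sq_def by (rule suminf_mult[OF summable_square_coeff])
  finally show ?thesis using sq_ge_1[of "r\<^sup>2"] by (simp add: log_deriv_sigma_eq field_simps)
qed

text \<open>The growth comparison of \<open>log_deriv_sigma_unbounded\<close>, now with an explicit
  rate.\<close>

lemma log_deriv_sigma_ge_degree:
  assumes ad: "a d \<noteq> 0" and r: "r > 1"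
  shows "real d - (ln (sigma a 1) - ln (norm (a d))) / ln r \<le> log_deriv_sigma a r"
proof -
  have "((norm (a d)) * r ^ d)\<^sup>2 \<le> (sigma a r)\<^sup>2"
    using sq_ge_term[of "r\<^sup>2" d] by (simp add: sigma_square power_mult_distrib power_mult[symmetric] mult.commute)
  then have "norm (a d) * r ^ d \<le> sigma a r"
    by (rule power2_le_imp_le) (use sigma_pos less_imp_le in blast)
  then have "ln (norm (a d) * r ^ d) \<le> ln (sigma a r)" using ad r by (intro ln_mono) auto
  then have "ln (norm (a d)) + real d * ln r \<le> ln (sigma a r)"
    using ad r by (simp add: ln_mult ln_realpow)
  also have "\<dots> \<le> ln (sigma a 1) + log_deriv_sigma a r * ln r"
    using ln_sigma_increment_le[of 1 r] r by simp
  finally show ?thesis using r by (simp add: field_simps)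
qed

lemma jensen_sum_polynomial_le:
  assumes deg: "\<forall>n>d. a n = 0" and sg: "sign_seq x" and r: "r \<ge> 1"
  shows "jensen_sum (signed_series a x) r \<le> real d * ln r + ln (majorant 1)"
proof -
  have m1: "majorant 1 \<ge> 1"
    using norm_signed_series_le[OF sg, of 0 1] norm_signed_series_0[OF sg] by simp
  have "majorant r \<le> r ^ d * majorant 1"
  proof -
    have "majorant r \<le> (\<Sum>n. r ^ d * (norm (a n) * 1 ^ n))"
      unfolding majorant_def
    proof (intro suminf_le summable_mult summable_coeff)
      fix n show "norm (a n) * r ^ n \<le> r ^ d * (norm (a n) * 1 ^ n)"
        using r by (cases "n \<le> d") (auto simp: deg mult.commute[of "r ^ d"] intro!: mult_left_mono power_increasing)
    qed (use r in auto)
    also have "\<dots> = r ^ d * majorant 1" unfolding majorant_def by (intro suminf_mult summable_coeff) simp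
    finally show ?thesis .
  qed
  then have "norm (signed_series a x z) \<le> r ^ d * majorant 1" if "norm z = r" for z
    using norm_signed_series_le[OF sg, of z r] that by linarith
  then have "jensen_sum (signed_series a x) r \<le> ln (r ^ d * majorant 1)"
    using r by (intro jensen_sum_le signed_series_holomorphic norm_signed_series_0 sg) auto
  also have "\<dots> = real d * ln r + ln (majorant 1)" using r m1 by (simp add: ln_mult ln_realpow)
  finally show ?thesis .
qed

lemma jensen_sum_polynomial_ge:
  assumes deg: "\<forall>n>d. a n = 0" and ad: "a d \<noteq> 0" and sg: "sign_seq x"
    and r: "r \<ge> 1" "r \<ge> 2 * majorant 1 / norm (a d)"
  shows "real d * ln r + ln (norm (a d) / 2) \<le> jensen_sum (signed_series a x) r"
proof -
  have "norm (a d) / 2 * r ^ d \<le> norm (signed_series a x z)" if z: "norm z = r" for z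
  proof -
    have "(\<Sum>n<d. norm (a n) * r ^ n) * r \<le> (\<Sum>n<d. norm (a n) * r ^ d)"
      unfolding sum_distrib_right
    proof (rule sum_mono)
      fix n assume "n \<in> {..<d}"
      then have "r ^ Suc n \<le> r ^ d" using r by (intro power_increasing) auto
      then have "norm (a n) * r ^ Suc n \<le> norm (a n) * r ^ d" by (rule mult_left_mono) simp
      then show "norm (a n) * r ^ n * r \<le> norm (a n) * r ^ d" by (simp add: mult_ac)
    qed
    also have "\<dots> \<le> majorant 1 * r ^ d"
    proof -
      have "(\<Sum>n<d. norm (a n) * 1 ^ n) \<le> majorant 1"
        unfolding majorant_def by (intro sum_le_suminf summable_coeff) auto
      then show ?thesis using r by (simp add: sum_distrib_right[symmetric] mult_right_mono)
    qed
    also have "\<dots> \<le> (norm (a d) / 2 * r ^ d) * r"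
    proof -
      have "majorant 1 \<le> norm (a d) / 2 * r" using r(2) ad by (simp add: field_simps)
      then have "majorant 1 * r ^ d \<le> norm (a d) / 2 * r * r ^ d" using r by (intro mult_right_mono) auto
      then show ?thesis by (simp add: mult_ac)
    qed
    finally have low: "(\<Sum>n<d. norm (a n) * r ^ n) \<le> norm (a d) / 2 * r ^ d" using r by simp
    have "signed_series a x z = a d * of_real (x d) * z ^ d + (\<Sum>n<d. a n * of_real (x n) * z ^ n)"
      unfolding signed_polynomial_eq[of d, OF deg] by (simp add: lessThan_Suc_atMost[symmetric])
    moreover have "norm (\<Sum>n<d. a n * of_real (x n) * z ^ n) \<le> (\<Sum>n<d. norm (a n) * r ^ n)"
      using sg z by (intro sum_norm_le) (auto simp: norm_mult norm_power sign_seq_def)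
    moreover have "norm (a d * of_real (x d) * z ^ d) = norm (a d) * r ^ d"
      using sg z by (simp add: norm_mult norm_power sign_seq_def)
    ultimately show ?thesis
      using low norm_diff_ineq[of "a d * of_real (x d) * z ^ d" "\<Sum>n<d. a n * of_real (x n) * z ^ n"] by simp
  qed
  then have "ln (norm (a d) / 2 * r ^ d) \<le> jensen_sum (signed_series a x) r"
    using r ad by (intro jensen_sum_ge_of_circle signed_series_holomorphic norm_signed_series_0 sg) auto
  moreover have "ln (norm (a d) / 2 * r ^ d) = real d * ln r + ln (norm (a d) / 2)"
    using r ad ln_mult[of "norm (a d) / 2" "r ^ d"] by (simp add: ln_realpow)
  ultimately show ?thesis by simp
qed

text \<open>The Jensen sum is d ln r up to a bounded error. Over a logarithmic length exceeding that
  error its slope determines the zero count to within less than 1, hence exactly.\<close>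

lemma zero_count_polynomial:
  assumes deg: "\<forall>n>d. a n = 0" and ad: "a d \<noteq> 0"
  shows "\<exists>r0\<ge>1. \<forall>x r. sign_seq x \<longrightarrow> r \<ge> r0 \<longrightarrow> zero_count (signed_series a x) r = d"
proof -
  define r1 where "r1 = max 1 (2 * majorant 1 / norm (a d))"
  define B where "B = \<bar>ln (majorant 1)\<bar> + \<bar>ln (norm (a d) / 2)\<bar>"
  \<comment> \<open>\<open>B\<close> bounds the width of the error interval, so
    \<open>B / t < 1\<close>.\<close>
  define t where "t = B + 1"
  have t: "t > 0" by (simp add: t_def B_def add_nonneg_pos)
  show ?thesis
  proof (intro exI[of _ "r1 * exp t"] conjI allI impI)
    show "1 \<le> r1 * exp t" using t mult_mono[of 1 r1 1 "exp t"] by (simp add: r1_def)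
    fix x r assume sg: "sign_seq x" and r: "r1 * exp t \<le> r"
    let ?f = "signed_series a x"
    have hol: "?f holomorphic_on UNIV" by (rule signed_series_holomorphic[OF sg])
    have f0: "?f 0 \<noteq> 0" using norm_signed_series_0[OF sg] by auto
    have J: "\<bar>jensen_sum ?f R' - jensen_sum ?f R - real d * ln (R' / R)\<bar> \<le> B" if "R \<ge> r1" "R' \<ge> r1" for R R'
    proof -
      have R: "R \<ge> 1" "R' \<ge> 1" "R \<ge> 2 * majorant 1 / norm (a d)" "R' \<ge> 2 * majorant 1 / norm (a d)"
        using that by (auto simp: r1_def)
      have e: "real d * ln (R' / R) = real d * ln R' - real d * ln R"
        using R by (simp add: ln_div right_diff_distrib)
      show ?thesis
        using jensen_sum_polynomial_le[OF deg sg R(1)] jensen_sum_polynomial_le[OF deg sg R(2)]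
          jensen_sum_polynomial_ge[OF deg ad sg R(1,3)] jensen_sum_polynomial_ge[OF deg ad sg R(2,4)]
        unfolding e B_def by linarith
    qed
    have r1: "r1 \<ge> 1" by (simp add: r1_def)
    have "r1 * 1 \<le> r1 * exp t" using t r1 by (intro mult_left_mono) auto
    then have rr: "r \<ge> r1" "r > 0" using r r1 by linarith+
    have le: "real (zero_count ?f r) * t \<le> real d * t + B"
    proof -
      have "r * 1 \<le> r * exp t" using t rr by (intro mult_left_mono) auto
      then have b: "r \<le> r * exp t" by simp
      have "real (zero_count ?f r) * ln (r * exp t / r) \<le> jensen_sum ?f (r * exp t) - jensen_sum ?f r"
        by (rule jensen_sum_increment(1)[OF hol f0 rr(2) b])
      also have "\<dots> \<le> real d * ln (r * exp t / r) + B" using J[of r "r * exp t"] rr b by linarith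
      finally show ?thesis using rr by simp
    qed
    have ge: "real d * t - B \<le> real (zero_count ?f r) * t"
    proof -
      define q where "q = r * exp (- t)"
      have "r1 * exp t * exp (- t) \<le> r * exp (- t)" using r by (intro mult_right_mono) auto
      then have q: "q \<ge> r1" by (simp add: q_def mult.assoc flip: exp_add)
      have "r * exp (- t) \<le> r * 1" using t rr by (intro mult_left_mono) auto
      then have qr: "q \<le> r" by (simp add: q_def)
      have lq: "ln (r / q) = t" using rr by (simp add: q_def exp_minus field_simps)
      have "real d * t - B \<le> jensen_sum ?f r - jensen_sum ?f q" using J[of q r] q rr lq by auto
      also have "\<dots> \<le> real (zero_count ?f r) * t"
        using jensen_sum_increment(2)[OF hol f0 _ qr] q r1 lq by simp
      finally show ?thesis .
    qed
    have "(real (zero_count ?f r) - real d) * t < 1 * t" using le by (simp add: left_diff_distrib t_def)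
    then have 1: "real (zero_count ?f r) - real d < 1" using t mult_less_cancel_right_pos by blast
    have "(real d - real (zero_count ?f r)) * t < 1 * t" using ge by (simp add: left_diff_distrib t_def)
    then have "real d - real (zero_count ?f r) < 1" using t mult_less_cancel_right_pos by blast
    with 1 show "zero_count ?f r = d" by linarith
  qed
qed

text \<open>The left side tends to 0 as \<open>?s r\<close> tends to \<open>d\<close>. For
  \<open>d \<ge> 2\<close> the right side stays away from 0, and for \<open>d = 0\<close> the zero
  count and \<open>?s r\<close> both vanish.\<close>

lemma zero_count_close_polynomial:
  assumes deg: "\<forall>n>d. a n = 0" and ad: "a d \<noteq> 0" and d: "d \<noteq> 1"
  shows "\<exists>r0\<ge>1. \<forall>x r. sign_seq x \<longrightarrow> r \<ge> r0 \<longrightarrow>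
    \<bar>real (zero_count (signed_series a x) r) - log_deriv_sigma a r\<bar>
     \<le> 3000 * sqrt (log_deriv_sigma a r) * (ln (log_deriv_sigma a r)) ^ 4"
proof -
  let ?s = "log_deriv_sigma a"
  obtain r0 where r0: "r0 \<ge> 1" "\<And>x r. sign_seq x \<Longrightarrow> r \<ge> r0 \<Longrightarrow> zero_count (signed_series a x) r = d"
    using zero_count_polynomial[OF deg ad] by blast
  show ?thesis
  proof (cases "d = 0")
    case True
    have "?s r = 0" for r using log_deriv_sigma_le_degree[OF deg, of r] log_deriv_sigma_nonneg[of r] True by simp
    then show ?thesis using r0 True by (intro exI[of _ r0]) auto
  next
    case False
    then have d2: "real d \<ge> 2" using d by simp
    define K where "K = ln (sigma a 1) - ln (norm (a d))"
    \<comment> \<open>Makes the deficit \<open>K / ln r\<close> at most 1/4, so that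
      \<open>?s r \<ge> 7 / 4\<close>.\<close>
    define r2 where "r2 = max r0 (exp (4 * \<bar>K\<bar> + 1))"
    have r2: "r2 \<ge> 1" using r0 by (simp add: r2_def)
    show ?thesis
    proof (intro exI[of _ r2] conjI allI impI r2)
      fix x r assume sg: "sign_seq x" and r: "r2 \<le> r"
      have re: "exp (4 * \<bar>K\<bar> + 1) \<le> r" "r \<ge> r0" using r by (auto simp: r2_def)
      have rp: "r > 0" using re(2) r0(1) by linarith
      have lr: "4 * \<bar>K\<bar> + 1 \<le> ln r" using re(1) rp by (simp add: ln_ge_iff)
      have "1 < exp (4 * \<bar>K\<bar> + 1)" by simp
      then have r1: "r > 1" using re(1) by linarith
      have "K / ln r \<le> 1 / 4" using lr by (simp add: field_simps)
      then have lo: "real d - 1 / 4 \<le> ?s r" using log_deriv_sigma_ge_degree[OF ad r1] unfolding K_def by linarith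
      have up: "?s r \<le> real d" by (rule log_deriv_sigma_le_degree[OF deg])
      have s: "?s r \<ge> 7 / 4" using lo d2 by linarith
      have "ln (?s r) \<ge> 3 / 7"
      proof -
        have "ln (4 / 7 :: real) \<le> 4 / 7 - 1" by (rule ln_le_minus_one) simp
        then have "3 / 7 \<le> ln (7 / 4 :: real)" by (simp add: ln_div)
        also have "\<dots> \<le> ln (?s r)" using s by (intro ln_mono) auto
        finally show ?thesis .
      qed
      then have "(3 / 7) ^ 4 \<le> (ln (?s r)) ^ 4" by (intro power_mono) auto
      moreover have "1 \<le> sqrt (?s r)" using s by simp
      ultimately have "3000 * (1 * (3 / 7) ^ 4) \<le> 3000 * (sqrt (?s r) * (ln (?s r)) ^ 4)"
        by (intro mult_left_mono mult_mono) auto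
      moreover have "\<bar>real (zero_count (signed_series a x) r) - ?s r\<bar> \<le> 1 / 4"
        using r0(2)[OF sg re(2)] lo up by simp
      moreover have "1 / 4 \<le> 3000 * (1 * (3 / 7 :: real) ^ 4)" by (simp add: power4_eq_xxxx)
      ultimately show "\<bar>real (zero_count (signed_series a x) r) - ?s r\<bar>
        \<le> 3000 * sqrt (?s r) * (ln (?s r)) ^ 4" by (simp only: mult.assoc)
    qed
  qed
qed

end

lemma zero_count_close_coin:
  assumes "conv_radius a = \<infinity>" "a 0 = 1" "\<not> (a 1 \<noteq> 0 \<and> (\<forall>n\<ge>2. a n = 0))"
  shows "\<exists>E. finite_log_measure E \<and> (AE b in coin_space. \<exists>r0\<ge>1. \<forall>r\<ge>r0. r \<notin> E \<longrightarrow>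
     \<bar>real (zero_count (signed_series a (\<lambda>n. coin_sign n b)) r) - log_deriv_sigma a r\<bar>
     \<le> 3000 * sqrt (log_deriv_sigma a r) * (ln (log_deriv_sigma a r)) ^ 4)"
proof -
  interpret unit_entire a using assms by unfold_locales
  show ?thesis
  proof (cases "\<forall>N. \<exists>n\<ge>N. a n \<noteq> 0")
    case True
    then show ?thesis by (intro zero_count_close_AE) blast
  next
    case False
    then obtain N where N: "\<And>n. n \<ge> N \<Longrightarrow> a n = 0" by blast
    define S where "S = {n. a n \<noteq> 0}"
    have "S \<subseteq> {..<N}" using N unfolding S_def by (auto simp: not_less[symmetric])
    then have fin: "finite S" using finite_subset by blast
    have "0 \<in> S" using a0 by (simp add: S_def)
    then have dS: "Max S \<in> S" using fin by (intro Max_in) auto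
    define d where "d = Max S"
    have ad: "a d \<noteq> 0" using dS by (simp add: S_def d_def)
    have deg: "\<forall>n>d. a n = 0"
    proof (intro allI impI)
      fix n assume "n > d"
      then show "a n = 0" using Max_ge[OF fin, of n] unfolding d_def S_def by force
    qed
    have "d \<noteq> 1" using assms(3) ad deg by auto
    from zero_count_close_polynomial[OF deg ad this] obtain r0 where r0: "r0 \<ge> 1"
      "\<And>x r. sign_seq x \<Longrightarrow> r \<ge> r0 \<Longrightarrow> \<bar>real (zero_count (signed_series a x) r) - log_deriv_sigma a r\<bar>
     \<le> 3000 * sqrt (log_deriv_sigma a r) * (ln (log_deriv_sigma a r)) ^ 4" by blast
    \<comment> \<open>For polynomials the exceptional set is empty and \<open>r0\<close> is even
      non-random.\<close>
    have "finite_log_measure {}" by (simp add: finite_log_measure_def)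
    then show ?thesis using r0 sign_seq_coin by (intro exI[of _ "{}"] conjI AE_I2) auto
  qed
qed

theorem theorem21:
  shows "\<exists>C>0. \<forall>(M :: 'w measure) (\<xi> :: nat \<Rightarrow> 'w \<Rightarrow> real) (a :: nat \<Rightarrow> complex).
    rademacher_sequence M \<xi> \<and> conv_radius a = \<infinity> \<and> a 0 = 1 \<and>
    \<not> (a 1 \<noteq> 0 \<and> (\<forall>n\<ge>2. a n = 0)) \<longrightarrow>
    (\<exists>E. finite_log_measure E \<and>
      (AE \<omega> in M. \<exists>r0\<ge>1. \<forall>r\<ge>r0. r \<notin> E \<longrightarrow>
        \<bar>real (zero_count (signed_series a (\<lambda>n. \<xi> n \<omega>)) r) - log_deriv_sigma a r\<bar>
          \<le> C * sqrt (log_deriv_sigma a r) * (ln (log_deriv_sigma a r)) ^ 4))"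
proof (intro exI[of _ 3000] conjI allI impI)
  fix M :: "'w measure" and \<xi> :: "nat \<Rightarrow> 'w \<Rightarrow> real" and a :: "nat \<Rightarrow> complex"
  assume H: "rademacher_sequence M \<xi> \<and> conv_radius a = \<infinity> \<and> a 0 = 1 \<and>
    \<not> (a 1 \<noteq> 0 \<and> (\<forall>n\<ge>2. a n = 0))"
  then obtain E where E: "finite_log_measure E" "AE b in coin_space. \<exists>r0\<ge>1. \<forall>r\<ge>r0. r \<notin> E \<longrightarrow>
     \<bar>real (zero_count (signed_series a (\<lambda>n. coin_sign n b)) r) - log_deriv_sigma a r\<bar>
     \<le> 3000 * sqrt (log_deriv_sigma a r) * (ln (log_deriv_sigma a r)) ^ 4"
    using zero_count_close_coin by blast
  from H have "rademacher_sequence M \<xi>" by blast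
  \<comment> \<open>\<open>E\<close> was built on \<open>coin_space\<close> from \<open>a\<close>
    alone, so the same set serves every Rademacher sequence.\<close>
  from AE_rademacher_transfer[OF this, where P = "\<lambda>x. \<exists>r0\<ge>1. \<forall>r\<ge>r0. r \<notin> E \<longrightarrow>
     \<bar>real (zero_count (signed_series a x) r) - log_deriv_sigma a r\<bar>
     \<le> 3000 * sqrt (log_deriv_sigma a r) * (ln (log_deriv_sigma a r)) ^ 4", OF E(2)] E(1)
  show "\<exists>E. finite_log_measure E \<and>
      (AE \<omega> in M. \<exists>r0\<ge>1. \<forall>r\<ge>r0. r \<notin> E \<longrightarrow>
        \<bar>real (zero_count (signed_series a (\<lambda>n. \<xi> n \<omega>)) r) - log_deriv_sigma a r\<bar>
          \<le> 3000 * sqrt (log_deriv_sigma a r) * (ln (log_deriv_sigma a r)) ^ 4)"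
    by blast
qed simp

end
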